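(* Let $(M_1,g_1)$ and $(M_2,g_2)$ be pseudo-Riemannian manifolds of dimensions $n_1,n_2\neq 1$, let $f\colon M_1\to(0,\infty)$ be smooth, and let $M=M_1\times_f M_2$ be the warped product manifold with metric $g=g_1\oplus f^2g_2$. Assume $M$ is concircularly flat. Then $M$ is flat if $M_1$ admits a concircular vector field $\zeta_1$ and one of the following conditions holds: (1) $M_2$ admits a concircular vector field $\zeta_2$ and $f$ is constant; or (2) $\zeta_1(f)=f$.
   Context: The warped product metric is $g=\pi_1^*(g_1)+(f\circ\pi_1)^2\pi_2^*(g_2)$ on $M_1\times M_2$, with $\pi_i$ the natural projections. A vector field $\zeta$ on a pseudo-Riemannian manifold is concircular if $\nabla_X\zeta=\varphi X$ for every vector field $X$, for some smooth function $\varphi$. With $\mathcal R(X,Y)Z=\nabla_Y\nabla_XZ-\nabla_X\nabla_YZ+\nabla_{[X,Y]}Z$, the concircular curvature tensor of an $n$-dimensional pseudo-Riemannian manifold ($n\ge3$) with metric $g$ and scalar curvature $\tau$ is $\mathcal C(X,Y)Z=\mathcal R(X,Y)Z-\frac{\tau}{n(n-1)}[g(X,Z)Y-g(Y,Z)X]$; the manifold is concircularly flat if $\mathcal C=0$ and flat if $\mathcal R=0$. *)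

theory Defs
  imports "HOL-Analysis.Analysis"
begin

section \<open>Smooth maps on open subsets of normed spaces\<close>

text \<open>Only used for open sets \<open>S\<close>.\<close>

primrec Ck_on :: "nat \<Rightarrow> 'e::real_normed_vector set \<Rightarrow> ('e \<Rightarrow> 'f::real_normed_vector) \<Rightarrow> bool" where
  "Ck_on 0 S f \<longleftrightarrow> continuous_on S f"
| "Ck_on (Suc k) S f \<longleftrightarrow> (\<forall>x\<in>S. f differentiable (at x)) \<and>
     (\<forall>v. Ck_on k S (\<lambda>x. frechet_derivative f (at x) v))"

definition smooth_on :: "'e::real_normed_vector set \<Rightarrow> ('e \<Rightarrow> 'f::real_normed_vector) \<Rightarrow> bool" where
  "smooth_on S f \<longleftrightarrow> (\<forall>k. Ck_on k S f)"

section \<open>Smooth manifolds\<close>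

text \<open>A manifold has a whole topological type \<open>'a\<close> as its point set and is given by a (not
  necessarily maximal) smooth atlas whose charts take values in a Euclidean space \<open>'e\<close>; its
  dimension is \<open>DIM('e)\<close>. A chart is a pair of a domain and a map, of which only the
  values on the domain matter. Connectedness is not required.\<close>

type_synonym ('a, 'e) atlas = "('a set \<times> ('a \<Rightarrow> 'e)) set"

definition is_chart :: "'a::topological_space set \<Rightarrow> ('a \<Rightarrow> 'e::euclidean_space) \<Rightarrow> bool" where
  "is_chart U \<phi> \<longleftrightarrow> open U \<and> open (\<phi> ` U) \<and> homeomorphism U (\<phi> ` U) \<phi> (inv_into U \<phi>)"

definition smooth_manifold ::
  "('a::{t2_space,second_countable_topology}, 'e::euclidean_space) atlas \<Rightarrow> bool" where
  "smooth_manifold A \<longleftrightarrow>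
     (\<forall>(U, \<phi>)\<in>A. is_chart U \<phi>) \<and>
     (\<Union>(U, \<phi>)\<in>A. U) = UNIV \<and>
     (\<forall>(U, \<phi>)\<in>A. \<forall>(V, \<psi>)\<in>A. smooth_on (\<phi> ` (U \<inter> V)) (\<psi> \<circ> inv_into U \<phi>))"

definition smooth_fun_on ::
  "('a::topological_space, 'e::euclidean_space) atlas \<Rightarrow> 'a set \<Rightarrow> ('a \<Rightarrow> real) \<Rightarrow> bool" where
  "smooth_fun_on A W h \<longleftrightarrow> (\<forall>(U, \<phi>)\<in>A. smooth_on (\<phi> ` (U \<inter> W)) (h \<circ> inv_into U \<phi>))"

definition smooth_at ::
  "('a::topological_space, 'e::euclidean_space) atlas \<Rightarrow> 'a \<Rightarrow> ('a \<Rightarrow> real) \<Rightarrow> bool" where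
  "smooth_at A p h \<longleftrightarrow> (\<exists>W. open W \<and> p \<in> W \<and> smooth_fun_on A W h)"

section \<open>Tangent vectors and vector fields\<close>

text \<open>Tangent vectors at \<open>p\<close> are the velocities of smooth curves through \<open>p\<close>, each identified with
  the directional derivative that it induces on the functions that are smooth near \<open>p\<close>. To make a
  tangent vector determine its representation, all other functions are sent to \<open>0\<close>.
  The linear structure of a tangent space is the pointwise one.\<close>

type_synonym 'a tvec = "('a \<Rightarrow> real) \<Rightarrow> real"
type_synonym 'a vfield = "'a \<Rightarrow> 'a tvec"

definition smooth_curve_at_0 ::
  "('a::topological_space, 'e::euclidean_space) atlas \<Rightarrow> (real \<Rightarrow> 'a) \<Rightarrow> bool" where
  "smooth_curve_at_0 A \<gamma> \<longleftrightarrow> (\<exists>\<epsilon>>0. continuous_on {-\<epsilon><..<\<epsilon>} \<gamma> \<and>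
     (\<forall>(U, \<phi>)\<in>A. smooth_on {t \<in> {-\<epsilon><..<\<epsilon>}. \<gamma> t \<in> U} (\<phi> \<circ> \<gamma>)))"

definition velocity ::
  "('a::topological_space, 'e::euclidean_space) atlas \<Rightarrow> (real \<Rightarrow> 'a) \<Rightarrow> 'a tvec" where
  "velocity A \<gamma> = (\<lambda>h. if smooth_at A (\<gamma> 0) h then deriv (h \<circ> \<gamma>) 0 else 0)"

definition tangent_space ::
  "('a::topological_space, 'e::euclidean_space) atlas \<Rightarrow> 'a \<Rightarrow> 'a tvec set" where
  "tangent_space A p = {velocity A \<gamma> | \<gamma>. smooth_curve_at_0 A \<gamma> \<and> \<gamma> 0 = p}"

definition pushforward ::
  "('b::topological_space, 'e::euclidean_space) atlas \<Rightarrow> ('a \<Rightarrow> 'b) \<Rightarrow> 'a \<Rightarrow> 'a tvec \<Rightarrow> 'b tvec" where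
  "pushforward B F p v = (\<lambda>h. if smooth_at B (F p) h then v (h \<circ> F) else 0)"

definition vector_field ::
  "('a::topological_space, 'e::euclidean_space) atlas \<Rightarrow> 'a vfield \<Rightarrow> bool" where
  "vector_field A X \<longleftrightarrow> (\<forall>p. X p \<in> tangent_space A p) \<and>
     (\<forall>W h. open W \<and> smooth_fun_on A W h \<longrightarrow> smooth_fun_on A W (\<lambda>p. X p h))"

definition vf_zero :: "'a vfield" where
  "vf_zero = (\<lambda>p h. 0)"

definition vf_add :: "'a vfield \<Rightarrow> 'a vfield \<Rightarrow> 'a vfield" where
  "vf_add X Y = (\<lambda>p h. X p h + Y p h)"

definition vf_diff :: "'a vfield \<Rightarrow> 'a vfield \<Rightarrow> 'a vfield" where
  "vf_diff X Y = (\<lambda>p h. X p h - Y p h)"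

definition vf_scale :: "('a \<Rightarrow> real) \<Rightarrow> 'a vfield \<Rightarrow> 'a vfield" where
  "vf_scale a X = (\<lambda>p h. a p * X p h)"

definition lie_bracket ::
  "('a::topological_space, 'e::euclidean_space) atlas \<Rightarrow> 'a vfield \<Rightarrow> 'a vfield \<Rightarrow> 'a vfield" where
  "lie_bracket A X Y = (\<lambda>p h.
     if smooth_at A p h then X p (\<lambda>q. Y q h) - Y p (\<lambda>q. X q h) else 0)"

section \<open>Pseudo-Riemannian metrics\<close>

text \<open>Only the values of a metric \<open>g p\<close> on pairs of tangent vectors at \<open>p\<close> matter.\<close>

type_synonym 'a metric = "'a \<Rightarrow> 'a tvec \<Rightarrow> 'a tvec \<Rightarrow> real"

definition metric_fun :: "'a metric \<Rightarrow> 'a vfield \<Rightarrow> 'a vfield \<Rightarrow> 'a \<Rightarrow> real" where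
  "metric_fun g X Y = (\<lambda>p. g p (X p) (Y p))"

text \<open>The index at \<open>p\<close> is the largest dimension of a negative definite subspace of the tangent
  space; such a subspace is given by a basis \<open>e 0, \<dots>, e (k - 1)\<close>, whose linear independence
  is a consequence of the strict inequality.\<close>

definition metric_index ::
  "('a::topological_space, 'e::euclidean_space) atlas \<Rightarrow> 'a metric \<Rightarrow> 'a \<Rightarrow> nat" where
  "metric_index A g p = (GREATEST k. \<exists>e :: nat \<Rightarrow> 'a tvec.
     (\<forall>i<k. e i \<in> tangent_space A p) \<and>
     (\<forall>c :: nat \<Rightarrow> real. (\<exists>i<k. c i \<noteq> 0) \<longrightarrow>
        g p (\<lambda>h. \<Sum>i<k. c i * e i h) (\<lambda>h. \<Sum>i<k. c i * e i h) < 0))"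

definition pseudo_riemannian_metric ::
  "('a::topological_space, 'e::euclidean_space) atlas \<Rightarrow> 'a metric \<Rightarrow> bool" where
  "pseudo_riemannian_metric A g \<longleftrightarrow>
     (\<forall>p. \<forall>u\<in>tangent_space A p. \<forall>v\<in>tangent_space A p. g p u v = g p v u) \<and>
     (\<forall>p. \<forall>u\<in>tangent_space A p. \<forall>v\<in>tangent_space A p. \<forall>w\<in>tangent_space A p. \<forall>a b.
        g p (\<lambda>h. a * u h + b * v h) w = a * g p u w + b * g p v w) \<and>
     (\<forall>p. \<forall>u\<in>tangent_space A p. (\<forall>v\<in>tangent_space A p. g p u v = 0) \<longrightarrow> u = (\<lambda>h. 0)) \<and>
     (\<forall>X Y. vector_field A X \<and> vector_field A Y \<longrightarrow> smooth_fun_on A UNIV (metric_fun g X Y)) \<and>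
     (\<exists>\<nu>. \<forall>p. metric_index A g p = \<nu>)"

definition pseudo_riemannian_manifold ::
  "('a::{t2_space,second_countable_topology}, 'e::euclidean_space) atlas \<Rightarrow> 'a metric \<Rightarrow> bool" where
  "pseudo_riemannian_manifold A g \<longleftrightarrow> smooth_manifold A \<and> pseudo_riemannian_metric A g"

section \<open>The Levi-Civita connection and curvature\<close>

text \<open>\<open>D X Y\<close> is the covariant derivative of \<open>Y\<close> along \<open>X\<close>. Connections are only constrained on
  vector fields.\<close>

type_synonym 'a connection = "'a vfield \<Rightarrow> 'a vfield \<Rightarrow> 'a vfield"

definition affine_connection ::
  "('a::topological_space, 'e::euclidean_space) atlas \<Rightarrow> 'a connection \<Rightarrow> bool" where
  "affine_connection A D \<longleftrightarrow>
     (\<forall>X Y. vector_field A X \<and> vector_field A Y \<longrightarrow> vector_field A (D X Y)) \<and>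
     (\<forall>X X' Y. vector_field A X \<and> vector_field A X' \<and> vector_field A Y \<longrightarrow>
        D (vf_add X X') Y = vf_add (D X Y) (D X' Y)) \<and>
     (\<forall>a X Y. smooth_fun_on A UNIV a \<and> vector_field A X \<and> vector_field A Y \<longrightarrow>
        D (vf_scale a X) Y = vf_scale a (D X Y)) \<and>
     (\<forall>X Y Y'. vector_field A X \<and> vector_field A Y \<and> vector_field A Y' \<longrightarrow>
        D X (vf_add Y Y') = vf_add (D X Y) (D X Y')) \<and>
     (\<forall>a X Y. smooth_fun_on A UNIV a \<and> vector_field A X \<and> vector_field A Y \<longrightarrow>
        D X (vf_scale a Y) = vf_add (vf_scale (\<lambda>p. X p a) Y) (vf_scale a (D X Y)))"

definition levi_civita ::
  "('a::topological_space, 'e::euclidean_space) atlas \<Rightarrow> 'a metric \<Rightarrow> 'a connection \<Rightarrow> bool" where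
  "levi_civita A g D \<longleftrightarrow> affine_connection A D \<and>
     (\<forall>X Y. vector_field A X \<and> vector_field A Y \<longrightarrow>
        vf_diff (D X Y) (D Y X) = lie_bracket A X Y) \<and>
     (\<forall>X Y Z. vector_field A X \<and> vector_field A Y \<and> vector_field A Z \<longrightarrow>
        (\<forall>p. X p (metric_fun g Y Z) = metric_fun g (D X Y) Z p + metric_fun g Y (D X Z) p))"

text \<open>The sign convention is
  \<open>R(X,Y)Z = \<nabla>\<^sub>Y \<nabla>\<^sub>X Z - \<nabla>\<^sub>X \<nabla>\<^sub>Y Z + \<nabla>\<^bsub>[X,Y]\<^esub> Z\<close>.\<close>

definition riemann ::
  "('a::topological_space, 'e::euclidean_space) atlas \<Rightarrow> 'a connection \<Rightarrow>
     'a vfield \<Rightarrow> 'a vfield \<Rightarrow> 'a vfield \<Rightarrow> 'a vfield" where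
  "riemann A D X Y Z =
     vf_add (vf_diff (D Y (D X Z)) (D X (D Y Z))) (D (lie_bracket A X Y) Z)"

definition orthonormal_frame_at ::
  "('a::topological_space, 'e::euclidean_space) atlas \<Rightarrow> 'a metric \<Rightarrow> 'a \<Rightarrow> (nat \<Rightarrow> 'a vfield) \<Rightarrow> bool" where
  "orthonormal_frame_at A g p E \<longleftrightarrow>
     (\<forall>i<DIM('e). vector_field A (E i) \<and> \<bar>metric_fun g (E i) (E i) p\<bar> = 1) \<and>
     (\<forall>i<DIM('e). \<forall>j<DIM('e). i \<noteq> j \<longrightarrow> metric_fun g (E i) (E j) p = 0)"

text \<open>With the above sign convention, the Ricci tensor is the trace of \<open>V \<mapsto> R(X,V)Y\<close>, so that round
  spheres have positive scalar curvature. The traces do not depend on the choice of the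
  frame, and they only involve its values at \<open>p\<close>.\<close>

definition ricci ::
  "('a::topological_space, 'e::euclidean_space) atlas \<Rightarrow> 'a metric \<Rightarrow> 'a connection \<Rightarrow>
     'a vfield \<Rightarrow> 'a vfield \<Rightarrow> 'a \<Rightarrow> real" where
  "ricci A g D X Y p = (THE r. \<exists>E. orthonormal_frame_at A g p E \<and>
     r = (\<Sum>i<DIM('e). metric_fun g (E i) (E i) p * metric_fun g (riemann A D X (E i) Y) (E i) p))"

definition scalar_curvature ::
  "('a::topological_space, 'e::euclidean_space) atlas \<Rightarrow> 'a metric \<Rightarrow> 'a connection \<Rightarrow> 'a \<Rightarrow> real" where
  "scalar_curvature A g D p = (THE s. \<exists>E. orthonormal_frame_at A g p E \<and>
     s = (\<Sum>i<DIM('e). metric_fun g (E i) (E i) p * ricci A g D (E i) (E i) p))"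

definition concircular_curvature ::
  "('a::topological_space, 'e::euclidean_space) atlas \<Rightarrow> 'a metric \<Rightarrow> 'a connection \<Rightarrow>
     'a vfield \<Rightarrow> 'a vfield \<Rightarrow> 'a vfield \<Rightarrow> 'a vfield" where
  "concircular_curvature A g D X Y Z =
     vf_diff (riemann A D X Y Z)
       (vf_scale (\<lambda>p. scalar_curvature A g D p / (real DIM('e) * (real DIM('e) - 1)))
         (vf_diff (vf_scale (metric_fun g X Z) Y) (vf_scale (metric_fun g Y Z) X)))"

definition flat :: "('a::topological_space, 'e::euclidean_space) atlas \<Rightarrow> 'a connection \<Rightarrow> bool" where
  "flat A D \<longleftrightarrow> (\<forall>X Y Z. vector_field A X \<and> vector_field A Y \<and> vector_field A Z \<longrightarrow>
     riemann A D X Y Z = vf_zero)"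

definition concircularly_flat ::
  "('a::topological_space, 'e::euclidean_space) atlas \<Rightarrow> 'a metric \<Rightarrow> 'a connection \<Rightarrow> bool" where
  "concircularly_flat A g D \<longleftrightarrow>
     (\<forall>X Y Z. vector_field A X \<and> vector_field A Y \<and> vector_field A Z \<longrightarrow>
        concircular_curvature A g D X Y Z = vf_zero)"

definition concircular_vector_field ::
  "('a::topological_space, 'e::euclidean_space) atlas \<Rightarrow> 'a connection \<Rightarrow> 'a vfield \<Rightarrow> bool" where
  "concircular_vector_field A D \<zeta> \<longleftrightarrow> vector_field A \<zeta> \<and>
     (\<exists>\<phi>. smooth_fun_on A UNIV \<phi> \<and> (\<forall>X. vector_field A X \<longrightarrow> D X \<zeta> = vf_scale \<phi> X))"

section \<open>Warped products\<close>

definition product_atlas ::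
  "('a, 'e) atlas \<Rightarrow> ('b, 'f) atlas \<Rightarrow> ('a \<times> 'b, 'e \<times> 'f) atlas" where
  "product_atlas A B = {(U \<times> V, map_prod \<phi> \<psi>) | U \<phi> V \<psi>. (U, \<phi>) \<in> A \<and> (V, \<psi>) \<in> B}"

definition pullback_metric ::
  "('b::topological_space, 'e::euclidean_space) atlas \<Rightarrow> ('a \<Rightarrow> 'b) \<Rightarrow> 'b metric \<Rightarrow> 'a metric" where
  "pullback_metric B F g = (\<lambda>p u v. g (F p) (pushforward B F p u) (pushforward B F p v))"

definition warped_metric ::
  "('a::topological_space, 'e::euclidean_space) atlas \<Rightarrow> ('b::topological_space, 'f::euclidean_space) atlas \<Rightarrow>
     ('a \<Rightarrow> real) \<Rightarrow> 'a metric \<Rightarrow> 'b metric \<Rightarrow> ('a \<times> 'b) metric" where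
  "warped_metric A1 A2 f g1 g2 = (\<lambda>x u v.
     pullback_metric A1 fst g1 x u v + ((f \<circ> fst) x)\<^sup>2 * pullback_metric A2 snd g2 x u v)"

end

theory Submission
  imports Defs
begin

text \<open>Concircular flatness means \<open>R(X,Y)Z = K (g(X,Z) Y - g(Y,Z) X)\<close> for some function \<open>K\<close>, and it
  suffices to show \<open>K = 0\<close>. By the Koszul formula, the mixed curvature \<open>R(X,V)Z\<close> of fields \<open>X\<close>, \<open>Z\<close>
  lifted from \<open>M1\<close> and \<open>V\<close> lifted from \<open>M2\<close> is \<open>- Hess f(X,Z)/f V\<close>, so \<open>Hess f = - K f g1\<close>. If \<open>f\<close>
  is constant, this gives \<open>K = 0\<close> at once. Otherwise \<open>\<zeta>(f) = f\<close> with \<open>\<nabla> \<zeta> = \<phi> id\<close>, and the curvature of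
  the slices \<open>M1 \<times> {q}\<close> also gives \<open>\<zeta>(\<phi>) = - K g1(\<zeta>,\<zeta>)\<close>; these equations on \<open>M1\<close> force \<open>K = 0\<close>.\<close>

section \<open>Smooth maps\<close>

text \<open>The coefficient \<open>K\<close> is purely pointwise data: it comes from a
  \<open>THE\<close> and is not known to be smooth or constant, so it is only ever evaluated at a
  point or eliminated before anything is differentiated. Lifted fields are enough to show
  \<open>K = 0\<close>, and this kills the curvature on all fields at once. On lifts the Koszul
  formula determines \<open>D\<close>, because pairings with lifts separate the vector fields of the
  product. The foundations shape much of the work. Connections act on global fields, whereas the
  metric is pointwise and charts are local; bump functions bridge the gap by extending every tangent
  vector to a global field. Tangent vectors are functionals on all real functions with value 0 at
  the non-smooth ones, so an identity between them must hold there too; this explains the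
  \<open>smooth_at\<close> guards. Lie brackets are seen to be vector fields through
  torsion-freeness instead of a computation with second derivatives.\<close>

lemma Ck_on_cong:
  assumes "open S" "\<And>x. x \<in> S \<Longrightarrow> f x = g x"
  shows "Ck_on k S f \<longleftrightarrow> Ck_on k S g"
  using assms(2)
proof (induction k arbitrary: f g)
  case 0
  then show ?case using continuous_on_cong[of S S f g] by auto
next
  case (Suc k)
  have *: "f differentiable (at x) \<longleftrightarrow> g differentiable (at x)" if "x \<in> S" for x
    using that Suc.prems assms(1)
    unfolding differentiable_def by (metis has_derivative_transform_within_open)
  have **: "frechet_derivative f (at x) = frechet_derivative g (at x)"
    if "x \<in> S" "f differentiable (at x)" for x
    using frechet_derivative_transform_within_open that Suc.prems assms(1) by blast
  show ?case
  proof (cases "\<forall>x\<in>S. f differentiable (at x)")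
    case True
    then have "Ck_on k S (\<lambda>x. frechet_derivative f (at x) v) \<longleftrightarrow>
        Ck_on k S (\<lambda>x. frechet_derivative g (at x) v)" for v
      by (intro Suc.IH) (simp add: **)
    then show ?thesis using True * by simp
  next
    case False
    then show ?thesis using * by auto
  qed
qed

lemma Ck_on_subset: "Ck_on k S f \<Longrightarrow> T \<subseteq> S \<Longrightarrow> Ck_on k T f"
  by (induction k arbitrary: f) (auto intro: continuous_on_subset)

lemma Ck_on_Suc_imp_differentiable: "Ck_on (Suc k) S f \<Longrightarrow> x \<in> S \<Longrightarrow> f differentiable (at x)"
  by simp

lemma Ck_on_Suc_imp_has_derivative:
  "Ck_on (Suc k) S f \<Longrightarrow> x \<in> S \<Longrightarrow> (f has_derivative frechet_derivative f (at x)) (at x)"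
  by (simp add: frechet_derivative_works[symmetric])

lemma Ck_on_Suc_imp_Ck_on: "Ck_on (Suc k) S f \<Longrightarrow> Ck_on k S f"
proof (induction k arbitrary: f)
  case 0
  then show ?case
    by (auto intro!: continuous_at_imp_continuous_on differentiable_imp_continuous_within)
next
  case (Suc k)
  have 1: "\<forall>x\<in>S. f differentiable (at x)" using Suc.prems by simp
  have 2: "Ck_on (Suc k) S (\<lambda>x. frechet_derivative f (at x) v)" for v
    using Suc.prems Ck_on.simps(2)[of "Suc k" S f] by blast
  have "Ck_on k S (\<lambda>x. frechet_derivative f (at x) v)" for v
    by (rule Suc.IH[OF 2])
  with 1 show ?case by simp
qed

text \<open>Lets an induction name the derivative explicitly: \<open>Ck_on\<close> speaks of
  \<open>frechet_derivative\<close>, which agrees with \<open>f'\<close> on \<open>S\<close>, and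
  openness of \<open>S\<close> makes the values elsewhere harmless.\<close>

lemma Ck_on_SucI:
  assumes "open S" "\<And>x. x \<in> S \<Longrightarrow> (f has_derivative f' x) (at x)"
    and "\<And>v. Ck_on k S (\<lambda>x. f' x v)"
  shows "Ck_on (Suc k) S f"
proof -
  have "frechet_derivative f (at x) = f' x" if "x \<in> S" for x
    using frechet_derivative_at[OF assms(2)[OF that]] by simp
  then have "Ck_on k S (\<lambda>x. frechet_derivative f (at x) v)" for v
    using Ck_on_cong[OF assms(1), of "\<lambda>x. f' x v" "\<lambda>x. frechet_derivative f (at x) v" k] assms(3)
    by metis
  then show ?thesis using assms(2) by (auto simp: differentiable_def)
qed

lemma Ck_on_local:
  assumes "\<And>x. x \<in> S \<Longrightarrow> \<exists>T. open T \<and> x \<in> T \<and> Ck_on k T f"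
  shows "Ck_on k S f"
  using assms
proof (induction k arbitrary: f)
  case 0
  have "isCont f x" if "x \<in> S" for x
    using 0[OF that] by (auto simp: continuous_on_eq_continuous_at)
  then show ?case by (simp add: continuous_at_imp_continuous_on)
next
  case (Suc k)
  have 1: "\<forall>x\<in>S. f differentiable (at x)" using Suc.prems by force
  have "Ck_on k S (\<lambda>x. frechet_derivative f (at x) v)" for v
  proof (rule Suc.IH)
    fix x assume "x \<in> S"
    from Suc.prems[OF this] obtain T where "open T" "x \<in> T" "Ck_on (Suc k) T f" by blast
    then show "\<exists>T. open T \<and> x \<in> T \<and> Ck_on k T (\<lambda>x. frechet_derivative f (at x) v)" by auto
  qed
  with 1 show ?case by simp
qed

lemma Ck_on_const: "Ck_on k S (\<lambda>x. c)"
  by (induction k arbitrary: c) auto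

lemma Ck_on_add:
  assumes "open S" "Ck_on k S f" "Ck_on k S g"
  shows "Ck_on k S (\<lambda>x. f x + g x)"
  using assms(2,3)
proof (induction k arbitrary: f g)
  case (Suc k)
  show ?case
  proof (rule Ck_on_SucI[OF assms(1)])
    show "((\<lambda>x. f x + g x) has_derivative
        (\<lambda>v. frechet_derivative f (at x) v + frechet_derivative g (at x) v)) (at x)" if "x \<in> S" for x
      by (intro has_derivative_add Ck_on_Suc_imp_has_derivative[OF Suc.prems(1) that]
        Ck_on_Suc_imp_has_derivative[OF Suc.prems(2) that])
  qed (use Suc in auto)
qed (auto intro: continuous_intros)

lemma Ck_on_bounded_linear:
  assumes "open S" "bounded_linear L" "Ck_on k S f"
  shows "Ck_on k S (\<lambda>x. L (f x))"
  using assms(3)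
proof (induction k arbitrary: f)
  case 0
  then show ?case using bounded_linear.continuous_on[OF assms(2)] by auto
next
  case (Suc k)
  show ?case
  proof (rule Ck_on_SucI[OF assms(1)])
    show "((\<lambda>x. L (f x)) has_derivative (\<lambda>v. L (frechet_derivative f (at x) v))) (at x)"
      if "x \<in> S" for x
      by (intro bounded_linear.has_derivative[OF assms(2)] Ck_on_Suc_imp_has_derivative[OF Suc.prems(1) that])
  qed (use Suc in auto)
qed

lemma Ck_on_scaleR:
  assumes "open S" "Ck_on k S f" "Ck_on k S g"
  shows "Ck_on k S (\<lambda>x. f x *\<^sub>R g x)"
  using assms(2,3)
proof (induction k arbitrary: f g)
  case (Suc k)
  show ?case
  proof (rule Ck_on_SucI[OF assms(1)])
    show "((\<lambda>x. f x *\<^sub>R g x) has_derivative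
        (\<lambda>v. f x *\<^sub>R frechet_derivative g (at x) v + frechet_derivative f (at x) v *\<^sub>R g x)) (at x)"
      if "x \<in> S" for x
      by (intro has_derivative_scaleR Ck_on_Suc_imp_has_derivative[OF Suc.prems(1) that]
        Ck_on_Suc_imp_has_derivative[OF Suc.prems(2) that])
    fix v
    have "Ck_on k S f" "Ck_on k S g"
      using Suc.prems by (simp_all only: Ck_on_Suc_imp_Ck_on)
    moreover have "Ck_on k S (\<lambda>x. frechet_derivative f (at x) v)"
      "Ck_on k S (\<lambda>x. frechet_derivative g (at x) v)"
      using Suc.prems by simp_all
    ultimately show "Ck_on k S
        (\<lambda>x. f x *\<^sub>R frechet_derivative g (at x) v + frechet_derivative f (at x) v *\<^sub>R g x)"
      by (intro Ck_on_add Suc.IH assms(1))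
  qed
qed (auto intro: continuous_intros)

lemma Ck_on_sum:
  assumes "open S" "\<And>i. i \<in> I \<Longrightarrow> Ck_on k S (f i)"
  shows "Ck_on k S (\<lambda>x. \<Sum>i\<in>I. f i x)"
  using assms(2) by (induction I rule: infinite_finite_induct) (auto intro!: Ck_on_add Ck_on_const assms(1))

lemma Ck_on_ident: "open S \<Longrightarrow> Ck_on k S (\<lambda>x. x)"
  by (cases k) (auto simp: Ck_on_const)

text \<open>\<open>Ck_on\<close> differentiates in fixed directions only. The expansion turns a
  derivative in a moving direction into a finite sum of derivatives in fixed directions with varying
  coefficients.\<close>

lemma linear_eq_sum_Basis:
  fixes L :: "'e::euclidean_space \<Rightarrow> 'f::real_normed_vector"
  assumes "linear L"
  shows "L v = (\<Sum>b\<in>Basis. (v \<bullet> b) *\<^sub>R L b)"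
  by (metis (mono_tags, lifting) assms euclidean_representation linear_cmul linear_sum sum.cong)

text \<open>By the chain rule, the derivative in direction \<open>v\<close> is a finite sum over the
  basis of the middle space: a component of the derivative of \<open>f\<close> times a partial
  derivative of \<open>g\<close> composed with \<open>f\<close>. The latter is again such a
  composition, which is why the induction generalizes \<open>g\<close> and keeps
  \<open>f\<close>.\<close>

lemma Ck_on_compose:
  fixes f :: "'c::real_normed_vector \<Rightarrow> 'e::euclidean_space" and g :: "'e \<Rightarrow> 'f::real_normed_vector"
  assumes "open S" "Ck_on k S f" "Ck_on k T g" "f ` S \<subseteq> T"
  shows "Ck_on k S (\<lambda>x. g (f x))"
  using assms(2,3)
proof (induction k arbitrary: g)
  case 0
  then show ?case using continuous_on_compose2 assms(4) by auto
next
  case (Suc k)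
  show ?case
  proof (rule Ck_on_SucI[OF assms(1)])
    fix x assume x: "x \<in> S"
    then have fx: "f x \<in> T" using assms(4) by auto
    have "linear (frechet_derivative g (at (f x)))"
      using Suc.prems(2) fx by (intro linear_frechet_derivative) simp
    then have "frechet_derivative g (at (f x)) (frechet_derivative f (at x) v) =
        (\<Sum>b\<in>Basis. (frechet_derivative f (at x) v \<bullet> b) *\<^sub>R frechet_derivative g (at (f x)) b)" for v
      by (rule linear_eq_sum_Basis)
    moreover have "((\<lambda>x. g (f x)) has_derivative
        (\<lambda>v. frechet_derivative g (at (f x)) (frechet_derivative f (at x) v))) (at x)"
      using has_derivative_compose[OF Ck_on_Suc_imp_has_derivative[OF Suc.prems(1) x]
          Ck_on_Suc_imp_has_derivative[OF Suc.prems(2) fx]] .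
    ultimately show "((\<lambda>x. g (f x)) has_derivative
        (\<lambda>v. \<Sum>b\<in>Basis. (frechet_derivative f (at x) v \<bullet> b) *\<^sub>R frechet_derivative g (at (f x)) b)) (at x)"
      by (simp only:)
  next
    fix v
    have "Ck_on k S (\<lambda>x. frechet_derivative g (at (f x)) b)" for b
      using Suc.prems(2) by (intro Suc.IH Ck_on_Suc_imp_Ck_on[OF Suc.prems(1)]) simp
    moreover have "Ck_on k S (\<lambda>x. frechet_derivative f (at x) v \<bullet> b)" for b
      using Suc.prems(1) by (intro Ck_on_bounded_linear[OF assms(1) bounded_linear_inner_left]) simp
    ultimately show "Ck_on k S (\<lambda>x. \<Sum>b\<in>Basis. (frechet_derivative f (at x) v \<bullet> b) *\<^sub>R
        frechet_derivative g (at (f x)) b)"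
      by (intro Ck_on_sum Ck_on_scaleR assms(1))
  qed
qed

text \<open>The derivative is a product of copies of \<open>inverse\<close> and a constant, so
  regularity of order \<open>k\<close> feeds order \<open>k + 1\<close>.\<close>

lemma Ck_on_inverse: "Ck_on k (- {0}) (inverse :: real \<Rightarrow> real)"
proof (induction k)
  case 0
  then show ?case by (auto intro!: continuous_intros)
next
  case (Suc k)
  show ?case
  proof (rule Ck_on_SucI)
    show "(inverse has_derivative (\<lambda>v. - (inverse x * v * inverse x))) (at x)" if "x \<in> - {0}"
      for x :: real
      using that has_derivative_inverse'[of x UNIV] by simp
    have "Ck_on k (- {0}) (\<lambda>x::real. (- v) *\<^sub>R (inverse x *\<^sub>R inverse x))" for v :: real
      using Suc by (intro Ck_on_scaleR Ck_on_const) auto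
    then show "Ck_on k (- {0}) (\<lambda>x. - (inverse x * v * inverse x))" for v :: real
      by (simp add: mult_ac)
  qed auto
qed

context
  fixes S :: "'c::real_normed_vector set"
  assumes S: "open S"
begin

lemma smooth_on_cong: "(\<And>x. x \<in> S \<Longrightarrow> f x = g x) \<Longrightarrow> smooth_on S f \<longleftrightarrow> smooth_on S g"
  unfolding smooth_on_def using Ck_on_cong[OF S] by blast

lemma smooth_on_transform: "smooth_on S f \<Longrightarrow> (\<And>x. x \<in> S \<Longrightarrow> f x = g x) \<Longrightarrow> smooth_on S g"
  using smooth_on_cong[of f g] by simp

lemma smooth_on_add: "smooth_on S f \<Longrightarrow> smooth_on S g \<Longrightarrow> smooth_on S (\<lambda>x. f x + g x)"
  unfolding smooth_on_def by (simp add: Ck_on_add[OF S])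

lemma smooth_on_scaleR: "smooth_on S f \<Longrightarrow> smooth_on S g \<Longrightarrow> smooth_on S (\<lambda>x. f x *\<^sub>R g x)"
  unfolding smooth_on_def by (simp add: Ck_on_scaleR[OF S])

lemma smooth_on_mult:
  fixes f g :: "'c \<Rightarrow> real"
  shows "smooth_on S f \<Longrightarrow> smooth_on S g \<Longrightarrow> smooth_on S (\<lambda>x. f x * g x)"
  using smooth_on_scaleR[of f g] by simp

lemma smooth_on_sum:
  "(\<And>i. i \<in> I \<Longrightarrow> smooth_on S (f i)) \<Longrightarrow> smooth_on S (\<lambda>x. \<Sum>i\<in>I. f i x)"
  unfolding smooth_on_def by (simp add: Ck_on_sum[OF S])

lemma smooth_on_bounded_linear: "bounded_linear L \<Longrightarrow> smooth_on S f \<Longrightarrow> smooth_on S (\<lambda>x. L (f x))"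
  unfolding smooth_on_def by (simp add: Ck_on_bounded_linear[OF S])

lemma smooth_on_ident: "smooth_on S (\<lambda>x. x)"
  unfolding smooth_on_def by (simp add: Ck_on_ident[OF S])

lemma smooth_on_compose:
  fixes f :: "'c \<Rightarrow> 'e::euclidean_space" and g :: "'e \<Rightarrow> 'f::real_normed_vector"
  shows "smooth_on S f \<Longrightarrow> smooth_on T g \<Longrightarrow> f ` S \<subseteq> T \<Longrightarrow> smooth_on S (\<lambda>x. g (f x))"
  unfolding smooth_on_def using Ck_on_compose[OF S] by blast

lemma smooth_on_divide:
  fixes f g :: "'c \<Rightarrow> real"
  assumes "smooth_on S f" "smooth_on S g" "\<And>x. x \<in> S \<Longrightarrow> g x \<noteq> 0"
  shows "smooth_on S (\<lambda>x. f x / g x)"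
proof -
  have "smooth_on (- {0}) (inverse :: real \<Rightarrow> real)"
    using Ck_on_inverse by (simp add: smooth_on_def)
  then have "smooth_on S (\<lambda>x. inverse (g x))"
    using assms by (intro smooth_on_compose[OF assms(2)]) auto
  then show ?thesis using smooth_on_mult[OF assms(1)] by (simp add: divide_inverse)
qed

lemma smooth_on_Pair:
  fixes f :: "'c \<Rightarrow> 'e::real_normed_vector" and g :: "'c \<Rightarrow> 'f::real_normed_vector"
  assumes "smooth_on S f" "smooth_on S g"
  shows "smooth_on S (\<lambda>x. (f x, g x))"
proof -
  have "bounded_linear (\<lambda>x::'e. (x, 0::'f))" "bounded_linear (\<lambda>x::'f. (0::'e, x))"
    by (intro bounded_linear_Pair bounded_linear_ident bounded_linear_zero)+
  from smooth_on_bounded_linear[OF this(1) assms(1)] smooth_on_bounded_linear[OF this(2) assms(2)]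
  show ?thesis using smooth_on_add by fastforce
qed

lemma smooth_on_components:
  fixes f :: "'c \<Rightarrow> 'e::euclidean_space"
  assumes "\<And>b. b \<in> Basis \<Longrightarrow> smooth_on S (\<lambda>x. f x \<bullet> b)"
  shows "smooth_on S f"
proof -
  have "smooth_on S (\<lambda>x. \<Sum>b\<in>Basis. (f x \<bullet> b) *\<^sub>R b)"
    using assms by (intro smooth_on_sum smooth_on_scaleR) (auto simp: smooth_on_def Ck_on_const)
  then show ?thesis by (simp add: euclidean_representation)
qed

end

lemma smooth_on_const: "smooth_on S (\<lambda>x. c)"
  by (simp add: smooth_on_def Ck_on_const)

lemma smooth_on_subset: "smooth_on S f \<Longrightarrow> T \<subseteq> S \<Longrightarrow> smooth_on T f"
  unfolding smooth_on_def using Ck_on_subset by blast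

lemma smooth_on_local:
  "(\<And>x. x \<in> S \<Longrightarrow> \<exists>T. open T \<and> x \<in> T \<and> smooth_on T f) \<Longrightarrow> smooth_on S f"
  unfolding smooth_on_def by (meson Ck_on_local)

lemma smooth_on_imp_differentiable: "smooth_on S f \<Longrightarrow> x \<in> S \<Longrightarrow> f differentiable (at x)"
  unfolding smooth_on_def by (rule Ck_on_Suc_imp_differentiable[of 0]) simp_all

lemma smooth_on_Times_fst:
  fixes f :: "'e::euclidean_space \<Rightarrow> 'g::real_normed_vector" and T :: "'f::real_normed_vector set"
  assumes "open S" "open T" "smooth_on S f"
  shows "smooth_on (S \<times> T) (\<lambda>z. f (fst z))"
proof -
  have o: "open (S \<times> T)" using assms by (intro open_Times)
  have "smooth_on (S \<times> T) fst"
    using smooth_on_bounded_linear[OF o bounded_linear_fst smooth_on_ident[OF o]] by simp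
  from smooth_on_compose[OF o this assms(3)] show ?thesis by auto
qed

lemma smooth_on_Times_snd:
  fixes f :: "'e::euclidean_space \<Rightarrow> 'g::real_normed_vector" and S :: "'f::real_normed_vector set"
  assumes "open S" "open T" "smooth_on T f"
  shows "smooth_on (S \<times> T) (\<lambda>z. f (snd z))"
proof -
  have o: "open (S \<times> T)" using assms by (intro open_Times)
  have "smooth_on (S \<times> T) snd"
    using smooth_on_bounded_linear[OF o bounded_linear_snd smooth_on_ident[OF o]] by simp
  from smooth_on_compose[OF o this assms(3)] show ?thesis by auto
qed

lemma smooth_on_frechet_derivative:
  "smooth_on S f \<Longrightarrow> smooth_on S (\<lambda>x. frechet_derivative f (at x) v)"
  unfolding smooth_on_def
proof
  fix k assume "\<forall>k. Ck_on k S f"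
  then have "Ck_on (Suc k) S f" ..
  then show "Ck_on k S (\<lambda>x. frechet_derivative f (at x) v)" by simp
qed

text \<open>In coordinates this is a vector field with coefficients \<open>w\<close> acting on
  \<open>f\<close>.\<close>

lemma smooth_on_frechet_derivative_apply:
  fixes f :: "'e::euclidean_space \<Rightarrow> 'f::real_normed_vector"
  assumes S: "open S" and f: "smooth_on S f" and w: "smooth_on S w"
  shows "smooth_on S (\<lambda>x. frechet_derivative f (at x) (w x))"
proof -
  have "smooth_on S (\<lambda>x. \<Sum>b\<in>Basis. (w x \<bullet> b) *\<^sub>R frechet_derivative f (at x) b)"
    using smooth_on_bounded_linear[OF S bounded_linear_inner_left w]
    by (intro smooth_on_sum smooth_on_scaleR S smooth_on_frechet_derivative f)
  moreover have "frechet_derivative f (at x) (w x) =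
      (\<Sum>b\<in>Basis. (w x \<bullet> b) *\<^sub>R frechet_derivative f (at x) b)" if "x \<in> S" for x
    using linear_eq_sum_Basis[OF linear_frechet_derivative[OF smooth_on_imp_differentiable[OF f that]]] .
  ultimately show ?thesis
    using smooth_on_cong[OF S, of "\<lambda>x. frechet_derivative f (at x) (w x)"] by simp
qed

section \<open>Smooth bump functions\<close>

definition flat_exp :: "nat \<Rightarrow> real \<Rightarrow> real" where
  "flat_exp n x = (if 0 < x then exp (- inverse x) * inverse x ^ n else 0)"

text \<open>Only \<open>n = 0\<close> is wanted for the bump function, but the family over all
  \<open>n\<close> is closed under differentiation up to linear combinations, so that one induction
  settles smoothness.\<close>

lemma flat_exp_DERIV:
  "(flat_exp n has_real_derivative (- real n * flat_exp (Suc n) x + flat_exp (n + 2) x)) (at x)"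
proof -
  consider "0 < x" | "x < 0" | "x = 0" by linarith
  then show ?thesis
  proof cases
    case 1
    have "((\<lambda>x. exp (- inverse x) * inverse x ^ n) has_real_derivative
        - real n * flat_exp (Suc n) x + flat_exp (n + 2) x) (at x)"
      using 1 by (auto intro!: derivative_eq_intros simp: flat_exp_def)
        (cases n; simp add: algebra_simps power2_eq_square)
    then show ?thesis
      by (rule has_field_derivative_transform_within_open[of _ _ _ "{0<..}"])
        (use 1 in \<open>auto simp: flat_exp_def\<close>)
  next
    case 2
    have "(flat_exp n has_real_derivative 0) (at x)"
      by (rule has_field_derivative_transform_within_open[of "\<lambda>_. 0" _ x "{..<0}"])
        (use 2 in \<open>auto simp: flat_exp_def\<close>)
    then show ?thesis using 2 by (simp add: flat_exp_def)
  next
    case 3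
    \<comment> \<open>The right difference quotient at 0 is \<open>flat_exp (Suc n)\<close>; with x
      = 1/h it becomes x^(n+1) exp(-x), which tends to 0 at infinity.\<close>
    have "((\<lambda>x. exp (- x) * x ^ Suc n) \<longlongrightarrow> (0::real)) at_top"
      using tendsto_power_div_exp_0[of "Suc n"] by (simp add: exp_minus divide_inverse mult.commute)
    then have "((\<lambda>x. exp (- inverse x) * inverse x ^ Suc n) \<longlongrightarrow> (0::real)) (at_right 0)"
      by (rule filterlim_compose[OF _ filterlim_inverse_at_top_right])
    then have R: "((\<lambda>h. flat_exp n h / h) \<longlongrightarrow> 0) (at_right 0)"
      by (rule Lim_transform_eventually)
        (auto simp: flat_exp_def eventually_at_filter divide_inverse)
    have L: "((\<lambda>h. flat_exp n h / h) \<longlongrightarrow> 0) (at_left 0)"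
      by (rule Lim_transform_eventually[OF tendsto_const])
        (auto simp: flat_exp_def eventually_at_filter)
    have "((\<lambda>h. flat_exp n h / h) \<longlongrightarrow> 0) (at 0)"
      using R L by (simp add: filterlim_split_at)
    then show ?thesis using 3 by (simp add: DERIV_def flat_exp_def[of _ 0])
  qed
qed

lemma smooth_on_flat_exp: "smooth_on UNIV (flat_exp n)"
proof -
  have "Ck_on k UNIV (flat_exp n)" for k n
  proof (induction k arbitrary: n)
    case 0
    show ?case
      using flat_exp_DERIV by (auto intro!: DERIV_isCont continuous_at_imp_continuous_on)
  next
    case (Suc k)
    show ?case
    proof (rule Ck_on_SucI)
      show "(flat_exp n has_derivative
          (\<lambda>v. v *\<^sub>R ((- real n) *\<^sub>R flat_exp (Suc n) x + flat_exp (n + 2) x))) (at x)" for x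
        using has_field_derivative_imp_has_derivative[OF flat_exp_DERIV[of n x]]
        by (simp add: mult_commute_abs)
      show "Ck_on k UNIV (\<lambda>x. v *\<^sub>R ((- real n) *\<^sub>R flat_exp (Suc n) x + flat_exp (n + 2) x))"
        for v :: real
        by (intro Ck_on_scaleR Ck_on_add Ck_on_const Suc open_UNIV)
    qed simp
  qed
  then show ?thesis by (simp add: smooth_on_def)
qed

lemma smooth_bump:
  fixes x0 :: "'e::euclidean_space"
  assumes "0 < r"
  obtains b :: "'e \<Rightarrow> real" where "smooth_on UNIV b" "b x0 = 1" "\<And>x. x \<notin> cball x0 r \<Longrightarrow> b x = 0"
proof
  \<comment> \<open>This is r^2 - |x - x0|^2, positive exactly on the open ball. It is spelled with
    sums and products of coordinates so that the closure rules for smoothness apply directly.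
    Composition with \<open>flat_exp 0\<close> cuts it off, and dividing by the value at
    \<open>x0\<close> normalizes.\<close>
  define q where "q = (\<lambda>x::'e. r\<^sup>2 + (-1) * (\<Sum>i\<in>Basis. ((x + (- x0)) \<bullet> i) * ((x + (- x0)) \<bullet> i)))"
  have q: "q x = r\<^sup>2 - (dist x0 x)\<^sup>2" for x
    unfolding q_def dist_norm euclidean_inner[symmetric] dot_square_norm
    by (simp add: norm_minus_commute)
  have "smooth_on UNIV q"
    unfolding q_def
    by (intro smooth_on_add smooth_on_mult smooth_on_sum smooth_on_const open_UNIV
        smooth_on_bounded_linear[OF _ bounded_linear_inner_left] smooth_on_ident)
  then have "smooth_on UNIV (\<lambda>x. flat_exp 0 (q x))"
    by (rule smooth_on_compose[OF open_UNIV _ smooth_on_flat_exp[of 0]]) simp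
  then show "smooth_on UNIV (\<lambda>x. inverse (flat_exp 0 (r\<^sup>2)) * flat_exp 0 (q x))"
    by (intro smooth_on_mult smooth_on_const open_UNIV)
  show "inverse (flat_exp 0 (r\<^sup>2)) * flat_exp 0 (q x0) = 1"
    using assms by (simp add: q flat_exp_def)
  show "inverse (flat_exp 0 (r\<^sup>2)) * flat_exp 0 (q x) = 0" if "x \<notin> cball x0 r" for x
  proof -
    have "r\<^sup>2 < (dist x0 x)\<^sup>2" using that assms by (intro power_strict_mono) auto
    then show ?thesis by (simp add: q flat_exp_def)
  qed
qed

section \<open>Tangent vectors in charts\<close>

text \<open>The tangent vector with coordinates \<open>w\<close> in a chart. The value 0 at
  functions not smooth near \<open>p\<close> copies the convention of \<open>velocity\<close>, so
  that both can be equal as functionals.\<close>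

definition chart_vec ::
  "('a::topological_space, 'e::euclidean_space) atlas \<Rightarrow> 'a set \<Rightarrow> ('a \<Rightarrow> 'e) \<Rightarrow> 'a \<Rightarrow> 'e \<Rightarrow> 'a tvec" where
  "chart_vec A U \<phi> p w =
     (\<lambda>h. if smooth_at A p h then frechet_derivative (h \<circ> inv_into U \<phi>) (at (\<phi> p)) w else 0)"

locale smooth_atlas =
  fixes A :: "('a::{t2_space,second_countable_topology}, 'e::euclidean_space) atlas"
  assumes smooth_manifold: "smooth_manifold A"
begin

lemma chart_homeomorphism:
  assumes "(U, \<phi>) \<in> A"
  shows "open U" "open (\<phi> ` U)" "homeomorphism U (\<phi> ` U) \<phi> (inv_into U \<phi>)"
  using smooth_manifold assms by (auto simp: smooth_manifold_def is_chart_def)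

lemma inv_chart [simp]:
  assumes "(U, \<phi>) \<in> A" "p \<in> U"
  shows "inv_into U \<phi> (\<phi> p) = p"
  using chart_homeomorphism(3)[OF assms(1)] assms(2) by (simp add: homeomorphism_apply1)

lemma chart_at: obtains U \<phi> where "(U, \<phi>) \<in> A" "p \<in> U"
proof -
  have "p \<in> (\<Union>(U, \<phi>)\<in>A. U)" using smooth_manifold by (simp add: smooth_manifold_def)
  then show ?thesis using that by auto
qed

lemma transition_smooth:
  assumes "(U, \<phi>) \<in> A" "(V, \<psi>) \<in> A"
  shows "smooth_on (\<phi> ` (U \<inter> V)) (\<psi> \<circ> inv_into U \<phi>)"
  using smooth_manifold assms unfolding smooth_manifold_def by blast

lemma open_chart_image:
  assumes C: "(U, \<phi>) \<in> A" and "open W"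
  shows "open (\<phi> ` (U \<inter> W))"
proof -
  have "\<phi> ` (U \<inter> W) = \<phi> ` U \<inter> inv_into U \<phi> -` W" using C by auto
  then show ?thesis
    using continuous_open_preimage[of "\<phi> ` U" "inv_into U \<phi>" W] chart_homeomorphism[OF C] assms(2)
    by (simp add: homeomorphism_cont2)
qed

lemma smooth_fun_onD:
  "smooth_fun_on A W h \<Longrightarrow> (U, \<phi>) \<in> A \<Longrightarrow> smooth_on (\<phi> ` (U \<inter> W)) (h \<circ> inv_into U \<phi>)"
  unfolding smooth_fun_on_def by blast

lemma smooth_fun_on_subset: "smooth_fun_on A W h \<Longrightarrow> W' \<subseteq> W \<Longrightarrow> smooth_fun_on A W' h"
  unfolding smooth_fun_on_def
  by (auto intro: smooth_on_subset[OF _ image_mono[OF Int_mono[OF order_refl]]])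

lemma smooth_fun_on_local:
  assumes "\<And>p. p \<in> W \<Longrightarrow> \<exists>W'. open W' \<and> p \<in> W' \<and> smooth_fun_on A W' h"
  shows "smooth_fun_on A W h"
  unfolding smooth_fun_on_def
proof clarify
  fix U \<phi> assume C: "(U, \<phi>) \<in> A"
  show "smooth_on (\<phi> ` (U \<inter> W)) (h \<circ> inv_into U \<phi>)"
  proof (rule smooth_on_local)
    fix x assume "x \<in> \<phi> ` (U \<inter> W)"
    then obtain p where p: "x = \<phi> p" "p \<in> U" "p \<in> W" by auto
    from assms[OF p(3)] obtain W' where W': "open W'" "p \<in> W'" "smooth_fun_on A W' h" by blast
    show "\<exists>T. open T \<and> x \<in> T \<and> smooth_on T (h \<circ> inv_into U \<phi>)"
      using open_chart_image[OF C W'(1)] smooth_fun_onD[OF W'(3) C] p W'(2) by blast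
  qed
qed

text \<open>One chart is enough: in any other chart the coordinate expression of \<open>h\<close> is
  the given one precomposed with a transition map.\<close>

lemma smooth_fun_on_chartI:
  assumes C: "(U, \<phi>) \<in> A" and W: "open W" "W \<subseteq> U" and h: "smooth_on (\<phi> ` W) (h \<circ> inv_into U \<phi>)"
  shows "smooth_fun_on A W h"
  unfolding smooth_fun_on_def
proof clarify
  fix V \<psi> assume C': "(V, \<psi>) \<in> A"
  have o: "open (\<psi> ` (V \<inter> W))" using open_chart_image[OF C' W(1)] .
  have "smooth_on (\<psi> ` (V \<inter> W)) (\<phi> \<circ> inv_into V \<psi>)"
    using transition_smooth[OF C' C] W(2) by (elim smooth_on_subset) auto
  moreover have "(\<phi> \<circ> inv_into V \<psi>) ` \<psi> ` (V \<inter> W) \<subseteq> \<phi> ` W"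
    using C' by auto
  ultimately have "smooth_on (\<psi> ` (V \<inter> W)) (\<lambda>x. (h \<circ> inv_into U \<phi>) ((\<phi> \<circ> inv_into V \<psi>) x))"
    by (rule smooth_on_compose[OF o, where f = "\<phi> \<circ> inv_into V \<psi>" and g = "h \<circ> inv_into U \<phi>", OF _ h])
  moreover have "(h \<circ> inv_into U \<phi>) ((\<phi> \<circ> inv_into V \<psi>) x) = (h \<circ> inv_into V \<psi>) x"
    if "x \<in> \<psi> ` (V \<inter> W)" for x
    using that C C' W(2) by auto
  ultimately show "smooth_on (\<psi> ` (V \<inter> W)) (h \<circ> inv_into V \<psi>)"
    by (rule smooth_on_transform[OF o])
qed

lemma smooth_fun_onI:
  assumes "\<And>p. p \<in> W \<Longrightarrow> \<exists>U \<phi> N. (U, \<phi>) \<in> A \<and> open N \<and> p \<in> N \<and> N \<subseteq> U \<and>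
    smooth_on (\<phi> ` N) (h \<circ> inv_into U \<phi>)"
  shows "smooth_fun_on A W h"
  by (rule smooth_fun_on_local) (meson assms smooth_fun_on_chartI)

lemma smooth_fun_on_coord:
  assumes "(U, \<phi>) \<in> A"
  shows "smooth_fun_on A U (\<lambda>p. \<phi> p \<bullet> b)"
proof (rule smooth_fun_on_chartI[OF assms])
  have "smooth_on (\<phi> ` U) (\<lambda>x. x \<bullet> b)"
    by (intro smooth_on_bounded_linear[OF _ bounded_linear_inner_left] smooth_on_ident
        chart_homeomorphism[OF assms])
  then show "smooth_on (\<phi> ` U) ((\<lambda>p. \<phi> p \<bullet> b) \<circ> inv_into U \<phi>)"
    by (subst smooth_on_cong[OF chart_homeomorphism(2)[OF assms], of _ "\<lambda>x. x \<bullet> b"])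
      (auto simp: assms)
qed (use chart_homeomorphism[OF assms] in auto)

lemma smooth_fun_on_const: "smooth_fun_on A W (\<lambda>p. c)"
  unfolding smooth_fun_on_def by (auto simp: comp_def smooth_on_const)

lemma smooth_fun_on_add:
  assumes "open W" "smooth_fun_on A W h" "smooth_fun_on A W k"
  shows "smooth_fun_on A W (\<lambda>p. h p + k p)"
  unfolding smooth_fun_on_def
proof clarify
  fix U \<phi> assume C: "(U, \<phi>) \<in> A"
  then show "smooth_on (\<phi> ` (U \<inter> W)) ((\<lambda>p. h p + k p) \<circ> inv_into U \<phi>)"
    using smooth_on_add[OF open_chart_image[OF C assms(1)] smooth_fun_onD[OF assms(2) C]
        smooth_fun_onD[OF assms(3) C]] by (simp add: comp_def)
qed

lemma smooth_fun_on_mult: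
  assumes "open W" "smooth_fun_on A W h" "smooth_fun_on A W k"
  shows "smooth_fun_on A W (\<lambda>p. h p * k p)"
  unfolding smooth_fun_on_def
proof clarify
  fix U \<phi> assume C: "(U, \<phi>) \<in> A"
  then show "smooth_on (\<phi> ` (U \<inter> W)) ((\<lambda>p. h p * k p) \<circ> inv_into U \<phi>)"
    using smooth_on_mult[OF open_chart_image[OF C assms(1)] smooth_fun_onD[OF assms(2) C]
        smooth_fun_onD[OF assms(3) C]] by (simp add: comp_def)
qed

lemma smooth_fun_on_divide:
  assumes "open W" "smooth_fun_on A W h" "smooth_fun_on A W k" "\<And>p. p \<in> W \<Longrightarrow> k p \<noteq> 0"
  shows "smooth_fun_on A W (\<lambda>p. h p / k p)"
  unfolding smooth_fun_on_def
proof clarify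
  fix U \<phi> assume C: "(U, \<phi>) \<in> A"
  then have "(k \<circ> inv_into U \<phi>) x \<noteq> 0" if "x \<in> \<phi> ` (U \<inter> W)" for x
    using that assms(4) by auto
  from smooth_on_divide[OF open_chart_image[OF C assms(1)] smooth_fun_onD[OF assms(2) C]
      smooth_fun_onD[OF assms(3) C] this]
  show "smooth_on (\<phi> ` (U \<inter> W)) ((\<lambda>p. h p / k p) \<circ> inv_into U \<phi>)"
    by (simp add: comp_def)
qed

lemma smooth_at_UNIV: "smooth_fun_on A UNIV h \<Longrightarrow> smooth_at A p h"
  unfolding smooth_at_def by blast

lemma smooth_at_binary:
  assumes "\<And>W. open W \<Longrightarrow> smooth_fun_on A W h \<Longrightarrow> smooth_fun_on A W k \<Longrightarrow> smooth_fun_on A W l"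
    and "smooth_at A p h" "smooth_at A p k"
  shows "smooth_at A p l"
proof -
  from assms obtain V W where "open V" "p \<in> V" "smooth_fun_on A V h" "open W" "p \<in> W" "smooth_fun_on A W k"
    unfolding smooth_at_def by blast
  then have "smooth_fun_on A (V \<inter> W) l" "open (V \<inter> W)" "p \<in> V \<inter> W"
    using assms(1)[of "V \<inter> W"] smooth_fun_on_subset[of V h "V \<inter> W"] smooth_fun_on_subset[of W k "V \<inter> W"]
    by auto
  then show ?thesis unfolding smooth_at_def by blast
qed

lemma smooth_at_imp_differentiable:
  assumes C: "(U, \<phi>) \<in> A" "p \<in> U" and "smooth_at A p h"
  shows "(h \<circ> inv_into U \<phi>) differentiable (at (\<phi> p))"
proof -
  from assms obtain W where W: "p \<in> W" "smooth_fun_on A W h" unfolding smooth_at_def by blast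
  show ?thesis
    using smooth_on_imp_differentiable[OF smooth_fun_onD[OF W(2) C(1)]] C(2) W(1) by auto
qed

lemma smooth_at_has_derivative:
  assumes "(U, \<phi>) \<in> A" "p \<in> U" "smooth_at A p h"
  shows "((h \<circ> inv_into U \<phi>) has_derivative
    frechet_derivative (h \<circ> inv_into U \<phi>) (at (\<phi> p))) (at (\<phi> p))"
  using smooth_at_imp_differentiable[OF assms] by (simp add: frechet_derivative_works[symmetric])

lemma curve_has_vector_derivative:
  assumes "(U, \<phi>) \<in> A" "smooth_curve_at_0 A \<gamma>" "\<gamma> 0 \<in> U"
  shows "\<exists>w. ((\<phi> \<circ> \<gamma>) has_vector_derivative w) (at 0)"
proof -
  from assms(2) obtain e where e: "0 < e" "\<forall>(U, \<phi>)\<in>A. smooth_on {t \<in> {-e<..<e}. \<gamma> t \<in> U} (\<phi> \<circ> \<gamma>)"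
    unfolding smooth_curve_at_0_def by blast
  then have "smooth_on {t \<in> {-e<..<e}. \<gamma> t \<in> U} (\<phi> \<circ> \<gamma>)" using assms(1) by auto
  from smooth_on_imp_differentiable[OF this, of 0] e(1) assms(3)
  have "(\<phi> \<circ> \<gamma>) differentiable (at 0)" by simp
  then show ?thesis by (auto simp: vector_derivative_works)
qed

text \<open>Chain rule for the factorization of \<open>h \<circ> \<gamma>\<close> through the chart.
  It is valid only at times when the curve is in \<open>U\<close>, which by continuity form a
  neighbourhood of 0.\<close>

lemma velocity_eq_chart_vec:
  assumes C: "(U, \<phi>) \<in> A" and \<gamma>: "smooth_curve_at_0 A \<gamma>" "\<gamma> 0 = p" "p \<in> U"
    and w: "((\<phi> \<circ> \<gamma>) has_vector_derivative w) (at 0)"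
  shows "velocity A \<gamma> = chart_vec A U \<phi> p w"
proof
  fix h
  show "velocity A \<gamma> h = chart_vec A U \<phi> p w h"
  proof (cases "smooth_at A p h")
    case True
    from \<gamma>(1) obtain e where e: "0 < e" "continuous_on {-e<..<e} \<gamma>"
      unfolding smooth_curve_at_0_def by blast
    let ?H = "h \<circ> inv_into U \<phi>"
    let ?T = "{-e<..<e} \<inter> \<gamma> -` U"
    have "open ?T" using e(2) chart_homeomorphism(1)[OF C] by (intro continuous_open_preimage) auto
    have d: "((\<phi> \<circ> \<gamma>) has_derivative (\<lambda>t. t *\<^sub>R w)) (at 0)"
      using w by (simp add: has_vector_derivative_def)
    have "(\<phi> \<circ> \<gamma>) 0 = \<phi> p" using \<gamma>(2) by simp
    then have "((\<lambda>t. ?H ((\<phi> \<circ> \<gamma>) t)) has_derivative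
        (\<lambda>t. frechet_derivative ?H (at (\<phi> p)) (t *\<^sub>R w))) (at 0)"
      using smooth_at_has_derivative[OF C \<gamma>(3) True] by (intro has_derivative_compose[OF d]) (simp only:)
    then have "((h \<circ> \<gamma>) has_derivative (\<lambda>t. frechet_derivative ?H (at (\<phi> p)) (t *\<^sub>R w))) (at 0)"
      by (rule has_derivative_transform_within_open[OF _ \<open>open ?T\<close>]) (use e(1) \<gamma> C in auto)
    then have "((h \<circ> \<gamma>) has_real_derivative frechet_derivative ?H (at (\<phi> p)) w) (at 0)"
      by (rule has_derivative_imp_has_field_derivative)
        (simp add: linear_cmul[OF linear_frechet_derivative[OF smooth_at_imp_differentiable[OF C \<gamma>(3) True]]])
    then show ?thesis using True \<gamma>(2) by (simp add: velocity_def chart_vec_def DERIV_imp_deriv)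
  qed (use \<gamma>(2) in \<open>auto simp: velocity_def chart_vec_def\<close>)
qed

text \<open>The curve is the coordinate line through \<open>\<phi> p\<close> with velocity
  \<open>w\<close>, pulled back by the chart. The line may leave the image of the chart, where
  \<open>inv_into\<close> is arbitrary, hence the restriction to times below
  \<open>e\<close>.\<close>

lemma chart_vec_in_tangent_space:
  assumes C: "(U, \<phi>) \<in> A" and p: "p \<in> U"
  shows "chart_vec A U \<phi> p w \<in> tangent_space A p"
proof -
  let ?l = "\<lambda>t::real. \<phi> p + t *\<^sub>R w"
  let ?\<gamma> = "\<lambda>t. inv_into U \<phi> (?l t)"
  have "open (?l -` (\<phi> ` U))"
    by (intro open_vimage chart_homeomorphism(2)[OF C] continuous_intros)
  moreover have "0 \<in> ?l -` (\<phi> ` U)" using p by auto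
  ultimately obtain e where e: "0 < e" "ball 0 e \<subseteq> ?l -` (\<phi> ` U)"
    using open_contains_ball by blast
  then have eU: "?l t \<in> \<phi> ` U" if "t \<in> {-e<..<e}" for t
    using that by (auto simp: subset_iff dist_real_def abs_if)
  have cont: "continuous_on {-e<..<e} ?\<gamma>"
    by (rule continuous_on_compose2[OF homeomorphism_cont2[OF chart_homeomorphism(3)[OF C]]])
      (use eU in \<open>auto intro!: continuous_intros\<close>)
  have l: "smooth_on T ?l" if "open T" for T :: "real set"
    by (intro smooth_on_add smooth_on_scaleR smooth_on_const smooth_on_ident that)
  have \<gamma>: "smooth_curve_at_0 A ?\<gamma>"
    unfolding smooth_curve_at_0_def
  proof (intro exI conjI, rule e(1), rule cont, clarify)
    fix V \<psi> assume C': "(V, \<psi>) \<in> A"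
    let ?T = "{t \<in> {-e<..<e}. ?\<gamma> t \<in> V}"
    have "?T = {-e<..<e} \<inter> ?\<gamma> -` V" by auto
    then have "open ?T"
      using continuous_open_preimage[OF cont, of V] chart_homeomorphism(1)[OF C'] by simp
    have "?l t \<in> \<phi> ` (U \<inter> V)" if t: "t \<in> ?T" for t
    proof -
      from eU[of t] t obtain u where u: "u \<in> U" "?l t = \<phi> u" by blast
      with t C have "u \<in> V" by simp
      then show ?thesis unfolding u(2) using u(1) by blast
    qed
    then have "smooth_on ?T (\<lambda>t. (\<psi> \<circ> inv_into U \<phi>) (?l t))"
      by (intro smooth_on_compose[OF \<open>open ?T\<close> l[OF \<open>open ?T\<close>] transition_smooth[OF C C']]) auto
    then show "smooth_on ?T (\<psi> \<circ> ?\<gamma>)" by (simp add: comp_def)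
  qed
  have "(?l has_vector_derivative w) (at 0)"
    by (auto intro!: derivative_eq_intros simp: has_vector_derivative_def)
  then have "((\<phi> \<circ> ?\<gamma>) has_vector_derivative w) (at 0)"
    unfolding has_vector_derivative_def
    by (rule has_derivative_transform_within_open[of _ _ _ _ "{-e<..<e}"])
      (use e(1) eU in \<open>auto simp: f_inv_into_f\<close>)
  then have "velocity A ?\<gamma> = chart_vec A U \<phi> p w"
    by (intro velocity_eq_chart_vec[OF C \<gamma>]) (use C p in auto)
  then show ?thesis unfolding tangent_space_def using \<gamma> C p by force
qed

text \<open>Gives the set of velocities its linear structure: curves cannot be added, but
  coordinates can.\<close>

lemma tangent_space_chart:
  assumes "(U, \<phi>) \<in> A" "p \<in> U"
  shows "tangent_space A p = range (chart_vec A U \<phi> p)"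
proof (intro equalityI subsetI)
  fix v assume "v \<in> tangent_space A p"
  then obtain \<gamma> where \<gamma>: "v = velocity A \<gamma>" "smooth_curve_at_0 A \<gamma>" "\<gamma> 0 = p"
    by (auto simp: tangent_space_def)
  then obtain w where "((\<phi> \<circ> \<gamma>) has_vector_derivative w) (at 0)"
    using curve_has_vector_derivative[OF assms(1)] assms(2) by blast
  from velocity_eq_chart_vec[OF assms(1) \<gamma>(2,3) assms(2) this] \<gamma>(1)
  show "v \<in> range (chart_vec A U \<phi> p)" by simp
qed (use chart_vec_in_tangent_space[OF assms] in auto)

lemma tangent_vec_cases:
  assumes "v \<in> tangent_space A p"
  obtains U \<phi> w where "(U, \<phi>) \<in> A" "p \<in> U" "v = chart_vec A U \<phi> p w"
proof -
  obtain U \<phi> where "(U, \<phi>) \<in> A" "p \<in> U" by (rule chart_at)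
  then show ?thesis using that tangent_space_chart assms by blast
qed

lemma chart_vec_linear:
  assumes "(U, \<phi>) \<in> A" "p \<in> U"
  shows "chart_vec A U \<phi> p (a *\<^sub>R u + b *\<^sub>R v) =
    (\<lambda>h. a * chart_vec A U \<phi> p u h + b * chart_vec A U \<phi> p v h)"
proof
  fix h
  show "chart_vec A U \<phi> p (a *\<^sub>R u + b *\<^sub>R v) h =
      a * chart_vec A U \<phi> p u h + b * chart_vec A U \<phi> p v h"
    using linear_frechet_derivative[OF smooth_at_imp_differentiable[OF assms], of h]
    by (simp add: chart_vec_def linear_add linear_cmul)
qed

lemma chart_vec_zero:
  assumes "(U, \<phi>) \<in> A" "p \<in> U"
  shows "chart_vec A U \<phi> p 0 = (\<lambda>h. 0)"
  using chart_vec_linear[OF assms, of 0 0 0 0] by simp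

text \<open>Applying the vector to coordinate functions recovers the components of \<open>w\<close>,
  so \<open>chart_vec\<close> is injective in \<open>w\<close>. The values of the chart off
  \<open>U\<close> do no harm because smoothness near \<open>p\<close> is enough.\<close>

lemma chart_vec_coord:
  assumes C: "(U, \<phi>) \<in> A" "p \<in> U"
  shows "chart_vec A U \<phi> p w (\<lambda>p. \<phi> p \<bullet> b) = w \<bullet> b"
proof -
  let ?h = "\<lambda>p. \<phi> p \<bullet> b"
  have s: "smooth_at A p ?h"
    unfolding smooth_at_def using smooth_fun_on_coord[OF C(1)] chart_homeomorphism[OF C(1)] C(2) by blast
  have "((\<lambda>x. x \<bullet> b) has_derivative (\<lambda>x. x \<bullet> b)) (at (\<phi> p))"
    by (intro bounded_linear_imp_has_derivative bounded_linear_inner_left)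
  then have "((?h \<circ> inv_into U \<phi>) has_derivative (\<lambda>x. x \<bullet> b)) (at (\<phi> p))"
    by (rule has_derivative_transform_within_open[of _ _ _ _ "\<phi> ` U"])
      (use chart_homeomorphism[OF C(1)] C in auto)
  from frechet_derivative_at[OF this, symmetric] s show ?thesis by (simp add: chart_vec_def)
qed

lemma tangent_space_lincomb:
  assumes "u \<in> tangent_space A p" "v \<in> tangent_space A p"
  shows "(\<lambda>h. a * u h + b * v h) \<in> tangent_space A p"
proof -
  obtain U \<phi> where C: "(U, \<phi>) \<in> A" "p \<in> U" by (rule chart_at)
  with assms obtain x y where "u = chart_vec A U \<phi> p x" "v = chart_vec A U \<phi> p y"
    using tangent_space_chart by blast
  then show ?thesis
    using chart_vec_linear[OF C, of a x b y] chart_vec_in_tangent_space[OF C] by metis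
qed

lemma zero_in_tangent_space: "(\<lambda>h. 0) \<in> tangent_space A p"
proof -
  obtain U \<phi> where C: "(U, \<phi>) \<in> A" "p \<in> U" by (rule chart_at)
  then show ?thesis using chart_vec_zero[OF C] chart_vec_in_tangent_space[OF C] by metis
qed

lemma tangent_vec_not_smooth: "v \<in> tangent_space A p \<Longrightarrow> \<not> smooth_at A p h \<Longrightarrow> v h = 0"
  by (auto simp: tangent_space_def velocity_def)

lemma tangent_vec_const: "v \<in> tangent_space A p \<Longrightarrow> v (\<lambda>p. c) = 0"
  by (auto simp: tangent_space_def velocity_def comp_def)

lemma tangent_vec_add:
  assumes "v \<in> tangent_space A p" "smooth_at A p h" "smooth_at A p k"
  shows "v (\<lambda>p. h p + k p) = v h + v k"
proof -
  from assms(1) obtain U \<phi> w where C: "(U, \<phi>) \<in> A" "p \<in> U" "v = chart_vec A U \<phi> p w"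
    by (rule tangent_vec_cases)
  have s: "smooth_at A p (\<lambda>p. h p + k p)"
    using smooth_at_binary[OF smooth_fun_on_add assms(2,3)] by simp
  from has_derivative_add[OF smooth_at_has_derivative[OF C(1,2) assms(2)]
      smooth_at_has_derivative[OF C(1,2) assms(3)]]
  have "((\<lambda>p. h p + k p) \<circ> inv_into U \<phi> has_derivative
      (\<lambda>x. frechet_derivative (h \<circ> inv_into U \<phi>) (at (\<phi> p)) x +
        frechet_derivative (k \<circ> inv_into U \<phi>) (at (\<phi> p)) x)) (at (\<phi> p))"
    by (simp add: comp_def)
  from frechet_derivative_at[OF this, symmetric] s assms C(3) show ?thesis
    by (simp add: chart_vec_def)
qed

lemma tangent_vec_mult:
  assumes "v \<in> tangent_space A p" "smooth_at A p h" "smooth_at A p k"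
  shows "v (\<lambda>p. h p * k p) = h p * v k + v h * k p"
proof -
  from assms(1) obtain U \<phi> w where C: "(U, \<phi>) \<in> A" "p \<in> U" "v = chart_vec A U \<phi> p w"
    by (rule tangent_vec_cases)
  have s: "smooth_at A p (\<lambda>p. h p * k p)"
    using smooth_at_binary[OF smooth_fun_on_mult assms(2,3)] by simp
  from has_derivative_mult[OF smooth_at_has_derivative[OF C(1,2) assms(2)]
      smooth_at_has_derivative[OF C(1,2) assms(3)]]
  have "((\<lambda>p. h p * k p) \<circ> inv_into U \<phi> has_derivative
      (\<lambda>x. h p * frechet_derivative (k \<circ> inv_into U \<phi>) (at (\<phi> p)) x +
        frechet_derivative (h \<circ> inv_into U \<phi>) (at (\<phi> p)) x * k p)) (at (\<phi> p))"
    using C by (simp add: comp_def)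
  from frechet_derivative_at[OF this, symmetric] s assms C(3) show ?thesis
    by (simp add: chart_vec_def)
qed

section \<open>Vector fields\<close>

lemma vector_field_tangent: "vector_field A X \<Longrightarrow> X p \<in> tangent_space A p"
  by (simp add: vector_field_def)

lemma vector_field_smooth:
  "vector_field A X \<Longrightarrow> open W \<Longrightarrow> smooth_fun_on A W h \<Longrightarrow> smooth_fun_on A W (\<lambda>p. X p h)"
  by (simp add: vector_field_def)

lemma vector_field_zero: "vector_field A vf_zero"
  by (simp add: vector_field_def vf_zero_def zero_in_tangent_space smooth_fun_on_const)

lemma vector_field_add:
  assumes "vector_field A X" "vector_field A Y"
  shows "vector_field A (vf_add X Y)"
  unfolding vector_field_def[of A "vf_add X Y"] unfolding vf_add_def
proof (intro conjI allI impI)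
  show "(\<lambda>h. X p h + Y p h) \<in> tangent_space A p" for p
    using tangent_space_lincomb[OF vector_field_tangent[OF assms(1)] vector_field_tangent[OF assms(2)],
      where a = 1 and b = 1] by simp
  show "smooth_fun_on A W (\<lambda>p. X p h + Y p h)" if "open W \<and> smooth_fun_on A W h" for W h
    using smooth_fun_on_add vector_field_smooth[OF assms(1)] vector_field_smooth[OF assms(2)] that
    by simp
qed

lemma vector_field_scale:
  assumes "smooth_fun_on A UNIV a" "vector_field A X"
  shows "vector_field A (vf_scale a X)"
  unfolding vector_field_def[of A "vf_scale a X"] unfolding vf_scale_def
proof (intro conjI allI impI)
  show "(\<lambda>h. a p * X p h) \<in> tangent_space A p" for p
    using tangent_space_lincomb[OF vector_field_tangent[OF assms(2)] zero_in_tangent_space,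
      where a = "a p" and b = 0]
    by simp
  show "smooth_fun_on A W (\<lambda>p. a p * X p h)" if "open W \<and> smooth_fun_on A W h" for W h
    using smooth_fun_on_mult[of W a] vector_field_smooth[OF assms(2)]
      smooth_fun_on_subset[OF assms(1), of W] that by simp
qed

lemma vector_field_diff:
  assumes "vector_field A X" "vector_field A Y"
  shows "vector_field A (vf_diff X Y)"
proof -
  have "vf_diff X Y = vf_add X (vf_scale (\<lambda>p. -1) Y)"
    by (simp add: vf_diff_def vf_add_def vf_scale_def)
  then show ?thesis
    using assms by (simp add: vector_field_add vector_field_scale smooth_fun_on_const)
qed

text \<open>The coordinate expression of \<open>X\<close> applied to \<open>h\<close> is the
  derivative of that of \<open>h\<close> in the smoothly moving direction \<open>\<xi>\<close>. Both
  extensions by bump functions and lifts are recognized as fields this way.\<close>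

lemma vector_fieldI:
  assumes "\<And>p. \<exists>U \<phi> N \<xi>. (U, \<phi>) \<in> A \<and> open N \<and> p \<in> N \<and> N \<subseteq> U \<and>
    smooth_on (\<phi> ` N) \<xi> \<and> (\<forall>p\<in>N. X p = chart_vec A U \<phi> p (\<xi> (\<phi> p)))"
  shows "vector_field A X"
  unfolding vector_field_def
proof (intro conjI allI impI)
  fix p
  from assms[of p] chart_vec_in_tangent_space show "X p \<in> tangent_space A p" by fastforce
next
  fix W h assume "open W \<and> smooth_fun_on A W h"
  then have W: "open W" and h: "smooth_fun_on A W h" by auto
  show "smooth_fun_on A W (\<lambda>p. X p h)"
  proof (rule smooth_fun_onI)
    fix p assume p: "p \<in> W"
    from assms[of p] obtain U \<phi> N \<xi> where C: "(U, \<phi>) \<in> A" and N: "open N" "p \<in> N" "N \<subseteq> U"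
      and \<xi>: "smooth_on (\<phi> ` N) \<xi>" "\<And>p. p \<in> N \<Longrightarrow> X p = chart_vec A U \<phi> p (\<xi> (\<phi> p))" by metis
    let ?N = "N \<inter> W" and ?H = "h \<circ> inv_into U \<phi>"
    have "U \<inter> ?N = ?N" using N(3) by auto
    then have o: "open (\<phi> ` ?N)" using open_chart_image[OF C, of ?N] N(1) W by (metis open_Int)
    have "smooth_on (\<phi> ` ?N) ?H"
      using smooth_fun_onD[OF h C] N(3) by (elim smooth_on_subset) auto
    moreover have "smooth_on (\<phi> ` ?N) \<xi>" using \<xi>(1) by (elim smooth_on_subset) auto
    ultimately have "smooth_on (\<phi> ` ?N) (\<lambda>x. frechet_derivative ?H (at x) (\<xi> x))"
      by (rule smooth_on_frechet_derivative_apply[OF o])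
    moreover have "frechet_derivative ?H (at x) (\<xi> x) = ((\<lambda>p. X p h) \<circ> inv_into U \<phi>) x"
      if x: "x \<in> \<phi> ` ?N" for x
    proof -
      from x obtain q where q: "x = \<phi> q" "q \<in> N" "q \<in> W" by auto
      then have "smooth_at A q h" using W h unfolding smooth_at_def by blast
      then show ?thesis using q \<xi>(2)[OF q(2)] C N(3) by (auto simp: chart_vec_def)
    qed
    ultimately have "smooth_on (\<phi> ` ?N) ((\<lambda>p. X p h) \<circ> inv_into U \<phi>)"
      by (rule smooth_on_transform[OF o])
    then show "\<exists>U \<phi> N. (U, \<phi>) \<in> A \<and> open N \<and> p \<in> N \<and> N \<subseteq> U \<and>
        smooth_on (\<phi> ` N) ((\<lambda>p. X p h) \<circ> inv_into U \<phi>)"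
      using C N W p by (intro exI[of _ U] exI[of _ \<phi>] exI[of _ ?N]) auto
  qed
qed

text \<open>Converse of \<open>vector_fieldI\<close>: the coefficients are \<open>X\<close> applied
  to the coordinate functions. These are smooth on \<open>U\<close>, so the clause of
  \<open>vector_field\<close> for functions on an open subset applies.\<close>

lemma vector_field_chart:
  assumes X: "vector_field A X" and C: "(U, \<phi>) \<in> A"
  obtains \<xi> where "smooth_on (\<phi> ` U) \<xi>" "\<And>p. p \<in> U \<Longrightarrow> X p = chart_vec A U \<phi> p (\<xi> (\<phi> p))"
proof
  \<comment> \<open>The choice is harmless, since \<open>chart_vec_coord\<close> forces every
    component.\<close>
  define c where "c p = (SOME w. X p = chart_vec A U \<phi> p w)" for p
  have c: "X p = chart_vec A U \<phi> p (c p)" if "p \<in> U" for p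
    unfolding c_def
    by (rule someI_ex) (use vector_field_tangent[OF X] tangent_space_chart[OF C that] in blast)
  show "X p = chart_vec A U \<phi> p ((c \<circ> inv_into U \<phi>) (\<phi> p))" if "p \<in> U" for p
    using c C that by simp
  show "smooth_on (\<phi> ` U) (c \<circ> inv_into U \<phi>)"
  proof (rule smooth_on_components)
    show o: "open (\<phi> ` U)" using chart_homeomorphism[OF C] by simp
    fix b :: 'e assume "b \<in> Basis"
    have "smooth_fun_on A U (\<lambda>p. X p (\<lambda>p. \<phi> p \<bullet> b))"
      using chart_homeomorphism[OF C] by (intro vector_field_smooth[OF X] smooth_fun_on_coord[OF C]) simp
    from smooth_fun_onD[OF this C]
    have "smooth_on (\<phi> ` U) ((\<lambda>p. X p (\<lambda>p. \<phi> p \<bullet> b)) \<circ> inv_into U \<phi>)" by simp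
    moreover have "((\<lambda>p. X p (\<lambda>p. \<phi> p \<bullet> b)) \<circ> inv_into U \<phi>) x = (c \<circ> inv_into U \<phi>) x \<bullet> b"
      if "x \<in> \<phi> ` U" for x
      using that c chart_vec_coord[OF C] C by auto
    ultimately show "smooth_on (\<phi> ` U) (\<lambda>x. (c \<circ> inv_into U \<phi>) x \<bullet> b)"
      by (rule smooth_on_transform[OF o])
  qed
qed

text \<open>Connections are constrained on global fields only, so pointwise arguments need every
  tangent vector to be a value of one. A field with constant coefficients in a chart is damped by a
  bump function.\<close>

lemma tangent_vec_extend:
  assumes "v \<in> tangent_space A p"
  obtains X where "vector_field A X" "X p = v"
proof -
  from assms obtain U \<phi> w where C: "(U, \<phi>) \<in> A" and p: "p \<in> U" and v: "v = chart_vec A U \<phi> p w"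
    by (rule tangent_vec_cases)
  have o: "open (\<phi> ` U)" using chart_homeomorphism[OF C] by simp
  with p obtain r where r: "0 < r" "cball (\<phi> p) r \<subseteq> \<phi> ` U"
    using open_contains_cball by blast
  obtain b :: "'e \<Rightarrow> real" where b: "smooth_on UNIV b" "b (\<phi> p) = 1"
    "\<And>x. x \<notin> cball (\<phi> p) r \<Longrightarrow> b x = 0"
    using smooth_bump[OF r(1)] by metis
  \<comment> \<open>Off this set the field is 0. It is closed in the whole manifold because it is
    compact in a Hausdorff space, and this makes the extension by 0 smooth at points outside
    \<open>U\<close>.\<close>
  define K where "K = inv_into U \<phi> ` cball (\<phi> p) r"
  have "compact K"
    unfolding K_def
    using homeomorphism_cont2[OF chart_homeomorphism(3)[OF C]] r(2)
    by (intro compact_continuous_image compact_cball) (rule continuous_on_subset)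
  then have K: "closed K" by (rule compact_imp_closed)
  have KU: "K \<subseteq> U" unfolding K_def using r(2) by (auto intro!: inv_into_into)
  have bK: "b (\<phi> q) = 0" if "q \<in> U" "q \<notin> K" for q
  proof (rule b(3))
    show "\<phi> q \<notin> cball (\<phi> p) r" using that C unfolding K_def by (metis image_eqI inv_chart)
  qed
  define X where "X q = (if q \<in> U then chart_vec A U \<phi> q (b (\<phi> q) *\<^sub>R w) else (\<lambda>h. 0))" for q
  have "vector_field A X"
  proof (rule vector_fieldI)
    fix q
    show "\<exists>V \<psi> N \<xi>. (V, \<psi>) \<in> A \<and> open N \<and> q \<in> N \<and> N \<subseteq> V \<and>
        smooth_on (\<psi> ` N) \<xi> \<and> (\<forall>p\<in>N. X p = chart_vec A V \<psi> p (\<xi> (\<psi> p)))"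
    proof (cases "q \<in> U")
      case True
      have "smooth_on (\<phi> ` U) (\<lambda>x. b x *\<^sub>R w)"
        by (intro smooth_on_scaleR[OF o] smooth_on_const smooth_on_subset[OF b(1)]) simp
      then show ?thesis
        using C True chart_homeomorphism[OF C]
        by (intro exI[of _ U] exI[of _ \<phi>] exI[of _ "\<lambda>x. b x *\<^sub>R w"]) (auto simp: X_def)
    next
      case False
      obtain V \<psi> where C': "(V, \<psi>) \<in> A" and q: "q \<in> V" by (rule chart_at)
      have "X p' = chart_vec A V \<psi> p' 0" if "p' \<in> V - K" for p'
        using that bK chart_vec_zero C C' by (auto simp: X_def)
      moreover have "open (V - K)" using K chart_homeomorphism[OF C'] by (intro open_Diff) auto
      ultimately show ?thesis
        using C' q False KU smooth_on_const
        by (intro exI[of _ V] exI[of _ \<psi>] exI[of _ "V - K"] exI[of _ "\<lambda>x. 0"]) auto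
    qed
  qed
  moreover have "X p = v" using p b(2) v by (simp add: X_def)
  ultimately show ?thesis using that by blast
qed

end

section \<open>Product manifolds\<close>

text \<open>The field with components \<open>X\<close> and \<open>Y\<close>, acting on
  \<open>h\<close> through its two slices. The guard does not follow from the summands: both slices
  can be smooth at a point where \<open>h\<close> is not.\<close>

definition lift ::
  "('a::topological_space, 'e::euclidean_space) atlas \<Rightarrow> ('b::topological_space, 'f::euclidean_space) atlas \<Rightarrow>
     'a vfield \<Rightarrow> 'b vfield \<Rightarrow> ('a \<times> 'b) vfield" where
  "lift A B X Y = (\<lambda>z h. if smooth_at (product_atlas A B) z h
     then X (fst z) (\<lambda>p. h (p, snd z)) + Y (snd z) (\<lambda>q. h (fst z, q)) else 0)"

locale product_manifold = M1: smooth_atlas A1 + M2: smooth_atlas A2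
  for A1 :: "('a::{t2_space,second_countable_topology}, 'e1::euclidean_space) atlas"
    and A2 :: "('b::{t2_space,second_countable_topology}, 'e2::euclidean_space) atlas"
begin

abbreviation "P \<equiv> product_atlas A1 A2"

lemma product_chart: "(U, \<phi>) \<in> A1 \<Longrightarrow> (V, \<psi>) \<in> A2 \<Longrightarrow> (U \<times> V, map_prod \<phi> \<psi>) \<in> P"
  by (auto simp: product_atlas_def)

lemma map_prod_image: "map_prod \<phi> \<psi> ` (U \<times> V) = \<phi> ` U \<times> \<psi> ` V"
  by force

lemma inv_product_chart:
  assumes "(U, \<phi>) \<in> A1" "(V, \<psi>) \<in> A2" "z \<in> \<phi> ` U \<times> \<psi> ` V"
  shows "inv_into (U \<times> V) (map_prod \<phi> \<psi>) z = (inv_into U \<phi> (fst z), inv_into V \<psi> (snd z))"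
proof -
  have "inj_on \<phi> U" "inj_on \<psi> V"
    using assms by (auto intro!: inj_on_inverseI[where g = "inv_into U \<phi>"] inj_on_inverseI[where g = "inv_into V \<psi>"])
  then have "inj_on (map_prod \<phi> \<psi>) (U \<times> V)" by (rule map_prod_inj_on)
  then show ?thesis
    using assms by (intro inv_into_f_eq) (auto simp: f_inv_into_f)
qed

lemma product_is_chart:
  assumes C1: "(U, \<phi>) \<in> A1" and C2: "(V, \<psi>) \<in> A2"
  shows "is_chart (U \<times> V) (map_prod \<phi> \<psi>)"
  unfolding is_chart_def map_prod_image
proof (intro conjI)
  note C = M1.chart_homeomorphism[OF C1] M2.chart_homeomorphism[OF C2]
  note inv = inv_product_chart[OF C1 C2]
  show "open (U \<times> V)" "open (\<phi> ` U \<times> \<psi> ` V)" using C by (auto intro: open_Times)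
  show "homeomorphism (U \<times> V) (\<phi> ` U \<times> \<psi> ` V) (map_prod \<phi> \<psi>) (inv_into (U \<times> V) (map_prod \<phi> \<psi>))"
  proof (rule homeomorphismI)
    have "continuous_on (U \<times> V) (\<lambda>z. (\<phi> (fst z), \<psi> (snd z)))"
      by (intro continuous_on_Pair continuous_on_compose2[OF homeomorphism_cont1[OF C(3)]]
          continuous_on_compose2[OF homeomorphism_cont1[OF C(6)]] continuous_intros) auto
    then show "continuous_on (U \<times> V) (map_prod \<phi> \<psi>)" by (simp add: map_prod_def case_prod_beta)
    have "continuous_on (\<phi> ` U \<times> \<psi> ` V) (\<lambda>z. (inv_into U \<phi> (fst z), inv_into V \<psi> (snd z)))"
      by (intro continuous_on_Pair continuous_on_compose2[OF homeomorphism_cont2[OF C(3)]]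
          continuous_on_compose2[OF homeomorphism_cont2[OF C(6)]] continuous_intros) auto
    then show "continuous_on (\<phi> ` U \<times> \<psi> ` V) (inv_into (U \<times> V) (map_prod \<phi> \<psi>))"
      by (subst continuous_on_cong[OF refl inv]) auto
    show "inv_into (U \<times> V) (map_prod \<phi> \<psi>) (map_prod \<phi> \<psi> z) = z" if "z \<in> U \<times> V" for z
      using that C1 C2 by (subst inv) auto
    show "map_prod \<phi> \<psi> (inv_into (U \<times> V) (map_prod \<phi> \<psi>) z) = z" if "z \<in> \<phi> ` U \<times> \<psi> ` V" for z
      using that by (subst inv) (auto simp: f_inv_into_f)
  qed (use C1 C2 inv in auto)
qed

lemma product_smooth_manifold: "smooth_manifold P"
  unfolding smooth_manifold_def
proof (intro conjI)
  show "\<forall>(U, \<phi>)\<in>P. is_chart U \<phi>" using product_is_chart by (auto simp: product_atlas_def)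
  have "z \<in> (\<Union>(U, \<phi>)\<in>P. U)" for z
  proof -
    obtain U \<phi> V \<psi> where "(U, \<phi>) \<in> A1" "fst z \<in> U" "(V, \<psi>) \<in> A2" "snd z \<in> V"
      using M1.chart_at[of "fst z"] M2.chart_at[of "snd z"] by metis
    then show ?thesis
      by (intro UN_I[of "(U \<times> V, map_prod \<phi> \<psi>)"] product_chart) (auto simp: mem_Times_iff)
  qed
  then show "(\<Union>(U, \<phi>)\<in>P. U) = UNIV" by auto
  show "\<forall>(U, \<phi>)\<in>P. \<forall>(V, \<psi>)\<in>P. smooth_on (\<phi> ` (U \<inter> V)) (\<psi> \<circ> inv_into U \<phi>)"
  proof clarify
    fix W \<alpha> W' \<beta> assume "(W, \<alpha>) \<in> P" "(W', \<beta>) \<in> P"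
    then obtain U \<phi> V \<psi> U' \<phi>' V' \<psi>' where W: "W = U \<times> V" "\<alpha> = map_prod \<phi> \<psi>" "W' = U' \<times> V'"
      "\<beta> = map_prod \<phi>' \<psi>'" and C: "(U, \<phi>) \<in> A1" "(V, \<psi>) \<in> A2" "(U', \<phi>') \<in> A1" "(V', \<psi>') \<in> A2"
      by (auto simp: product_atlas_def)
    let ?S = "\<phi> ` (U \<inter> U')" and ?T = "\<psi> ` (V \<inter> V')"
    have im: "\<alpha> ` (W \<inter> W') = ?S \<times> ?T" by (simp add: W Times_Int_Times map_prod_image)
    have oST: "open ?S" "open ?T"
      using M1.open_chart_image[OF C(1)] M2.open_chart_image[OF C(2)]
        M1.chart_homeomorphism(1)[OF C(3)] M2.chart_homeomorphism(1)[OF C(4)] by auto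
    then have o: "open (?S \<times> ?T)" by (intro open_Times)
    from smooth_on_Pair[OF o smooth_on_Times_fst[OF oST M1.transition_smooth[OF C(1,3)]]
        smooth_on_Times_snd[OF oST M2.transition_smooth[OF C(2,4)]]]
    show "smooth_on (\<alpha> ` (W \<inter> W')) (\<beta> \<circ> inv_into W \<alpha>)"
      unfolding im
      by (rule smooth_on_transform[OF o]) (auto simp: W inv_product_chart[OF C(1,2)] C)
  qed
qed

end

sublocale product_manifold \<subseteq> M: smooth_atlas "product_atlas A1 A2"
  by unfold_locales (rule product_smooth_manifold)

context product_manifold
begin

section \<open>Functions pulled back from a factor and functions restricted to slices\<close>

lemma smooth_fun_on_fst:
  assumes "open W" "smooth_fun_on A1 W a"
  shows "smooth_fun_on P (W \<times> UNIV) (\<lambda>z. a (fst z))"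
proof (rule M.smooth_fun_onI)
  fix z assume z: "z \<in> W \<times> (UNIV :: 'b set)"
  obtain U \<phi> V \<psi> where C: "(U, \<phi>) \<in> A1" "fst z \<in> U" "(V, \<psi>) \<in> A2" "snd z \<in> V"
    using M1.chart_at[of "fst z"] M2.chart_at[of "snd z"] by metis
  let ?N = "(U \<inter> W) \<times> V"
  have im: "map_prod \<phi> \<psi> ` ?N = \<phi> ` (U \<inter> W) \<times> \<psi> ` V" by (rule map_prod_image)
  have o: "open (\<phi> ` (U \<inter> W) \<times> \<psi> ` V)"
    using M1.open_chart_image[OF C(1) assms(1)] M2.chart_homeomorphism(2)[OF C(3)] by (intro open_Times) auto
  have "smooth_on (\<phi> ` (U \<inter> W) \<times> \<psi> ` V) (\<lambda>z. (a \<circ> inv_into U \<phi>) (fst z))"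
    by (intro smooth_on_Times_fst M1.smooth_fun_onD[OF assms(2) C(1)] M1.open_chart_image[OF C(1)]
        M2.chart_homeomorphism(2)[OF C(3)] assms(1))
  then have "smooth_on (map_prod \<phi> \<psi> ` ?N) ((\<lambda>z. a (fst z)) \<circ> inv_into (U \<times> V) (map_prod \<phi> \<psi>))"
    unfolding im
    by (rule smooth_on_transform[OF o]) (auto simp: inv_product_chart[OF C(1,3)] C)
  moreover have "open ?N"
    using M1.chart_homeomorphism(1)[OF C(1)] M2.chart_homeomorphism(1)[OF C(3)] assms(1)
    by (intro open_Times) auto
  ultimately show "\<exists>U \<phi> N. (U, \<phi>) \<in> P \<and> open N \<and> z \<in> N \<and> N \<subseteq> U \<and>
      smooth_on (\<phi> ` N) ((\<lambda>z. a (fst z)) \<circ> inv_into U \<phi>)"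
    using product_chart[OF C(1,3)] C z
    by (intro exI[of _ "U \<times> V"] exI[of _ "map_prod \<phi> \<psi>"] exI[of _ ?N]) (auto simp: mem_Times_iff)
qed

lemma smooth_fun_on_snd:
  assumes "open W" "smooth_fun_on A2 W a"
  shows "smooth_fun_on P (UNIV \<times> W) (\<lambda>z. a (snd z))"
proof (rule M.smooth_fun_onI)
  fix z assume z: "z \<in> (UNIV :: 'a set) \<times> W"
  obtain U \<phi> V \<psi> where C: "(U, \<phi>) \<in> A1" "fst z \<in> U" "(V, \<psi>) \<in> A2" "snd z \<in> V"
    using M1.chart_at[of "fst z"] M2.chart_at[of "snd z"] by metis
  let ?N = "U \<times> (V \<inter> W)"
  have im: "map_prod \<phi> \<psi> ` ?N = \<phi> ` U \<times> \<psi> ` (V \<inter> W)" by (rule map_prod_image)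
  have o: "open (\<phi> ` U \<times> \<psi> ` (V \<inter> W))"
    using M2.open_chart_image[OF C(3) assms(1)] M1.chart_homeomorphism(2)[OF C(1)] by (intro open_Times) auto
  have "smooth_on (\<phi> ` U \<times> \<psi> ` (V \<inter> W)) (\<lambda>z. (a \<circ> inv_into V \<psi>) (snd z))"
    by (intro smooth_on_Times_snd M2.smooth_fun_onD[OF assms(2) C(3)] M2.open_chart_image[OF C(3)]
        M1.chart_homeomorphism(2)[OF C(1)] assms(1))
  then have "smooth_on (map_prod \<phi> \<psi> ` ?N) ((\<lambda>z. a (snd z)) \<circ> inv_into (U \<times> V) (map_prod \<phi> \<psi>))"
    unfolding im
    by (rule smooth_on_transform[OF o]) (auto simp: inv_product_chart[OF C(1,3)] C)
  moreover have "open ?N"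
    using M1.chart_homeomorphism(1)[OF C(1)] M2.chart_homeomorphism(1)[OF C(3)] assms(1)
    by (intro open_Times) auto
  ultimately show "\<exists>U \<phi> N. (U, \<phi>) \<in> P \<and> open N \<and> z \<in> N \<and> N \<subseteq> U \<and>
      smooth_on (\<phi> ` N) ((\<lambda>z. a (snd z)) \<circ> inv_into U \<phi>)"
    using product_chart[OF C(1,3)] C z
    by (intro exI[of _ "U \<times> V"] exI[of _ "map_prod \<phi> \<psi>"] exI[of _ ?N]) (auto simp: mem_Times_iff)
qed

lemma smooth_fun_on_slice1:
  assumes W: "open W" "smooth_fun_on P W h"
  shows "open {p. (p, q) \<in> W}" "smooth_fun_on A1 {p. (p, q) \<in> W} (\<lambda>p. h (p, q))"
proof -
  have "open ((\<lambda>p. (p, q)) -` W)" by (intro open_vimage W continuous_intros)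
  then show oW: "open {p. (p, q) \<in> W}" by (simp add: vimage_def)
  show "smooth_fun_on A1 {p. (p, q) \<in> W} (\<lambda>p. h (p, q))"
    unfolding smooth_fun_on_def
  proof clarify
    fix U \<phi> assume C1: "(U, \<phi>) \<in> A1"
    obtain V \<psi> where C2: "(V, \<psi>) \<in> A2" "q \<in> V" by (rule M2.chart_at)
    let ?S = "\<phi> ` (U \<inter> {p. (p, q) \<in> W})"
    have o: "open ?S" using M1.open_chart_image[OF C1 oW] .
    have "smooth_on ?S (\<lambda>x. (x, \<psi> q))"
      by (intro smooth_on_Pair smooth_on_ident smooth_on_const o)
    moreover have "(\<lambda>x. (x, \<psi> q)) ` ?S \<subseteq> map_prod \<phi> \<psi> ` ((U \<times> V) \<inter> W)" using C2 by force
    ultimately have "smooth_on ?S (\<lambda>x. (h \<circ> inv_into (U \<times> V) (map_prod \<phi> \<psi>)) (x, \<psi> q))"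
      by (rule smooth_on_compose[OF o, where f = "\<lambda>x. (x, \<psi> q)",
            OF _ M.smooth_fun_onD[OF W(2) product_chart[OF C1 C2(1)]]])
    then show "smooth_on ?S ((\<lambda>p. h (p, q)) \<circ> inv_into U \<phi>)"
      by (rule smooth_on_transform[OF o]) (use C1 C2 in \<open>auto simp: inv_product_chart[OF C1 C2(1)]\<close>)
  qed
qed

lemma smooth_fun_on_slice2:
  assumes W: "open W" "smooth_fun_on P W h"
  shows "open {q. (p, q) \<in> W}" "smooth_fun_on A2 {q. (p, q) \<in> W} (\<lambda>q. h (p, q))"
proof -
  have "open ((\<lambda>q. (p, q)) -` W)" by (intro open_vimage W continuous_intros)
  then show oW: "open {q. (p, q) \<in> W}" by (simp add: vimage_def)
  show "smooth_fun_on A2 {q. (p, q) \<in> W} (\<lambda>q. h (p, q))"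
    unfolding smooth_fun_on_def
  proof clarify
    fix V \<psi> assume C2: "(V, \<psi>) \<in> A2"
    obtain U \<phi> where C1: "(U, \<phi>) \<in> A1" "p \<in> U" by (rule M1.chart_at)
    let ?S = "\<psi> ` (V \<inter> {q. (p, q) \<in> W})"
    have o: "open ?S" using M2.open_chart_image[OF C2 oW] .
    have "smooth_on ?S (\<lambda>x. (\<phi> p, x))"
      by (intro smooth_on_Pair smooth_on_ident smooth_on_const o)
    moreover have "(\<lambda>x. (\<phi> p, x)) ` ?S \<subseteq> map_prod \<phi> \<psi> ` ((U \<times> V) \<inter> W)" using C1 by force
    ultimately have "smooth_on ?S (\<lambda>x. (h \<circ> inv_into (U \<times> V) (map_prod \<phi> \<psi>)) (\<phi> p, x))"
      by (rule smooth_on_compose[OF o, where f = "\<lambda>x. (\<phi> p, x)",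
            OF _ M.smooth_fun_onD[OF W(2) product_chart[OF C1(1) C2]]])
    then show "smooth_on ?S ((\<lambda>q. h (p, q)) \<circ> inv_into V \<psi>)"
      by (rule smooth_on_transform[OF o]) (use C1 C2 in \<open>auto simp: inv_product_chart[OF C1(1) C2]\<close>)
  qed
qed

lemma smooth_at_slice1:
  assumes "smooth_at P (p, q) h" shows "smooth_at A1 p (\<lambda>p. h (p, q))"
proof -
  from assms obtain W where W: "open W" "(p, q) \<in> W" "smooth_fun_on P W h"
    unfolding smooth_at_def by blast
  then show ?thesis
    using smooth_fun_on_slice1[OF W(1,3), of q] unfolding smooth_at_def by blast
qed

lemma smooth_at_slice2:
  assumes "smooth_at P (p, q) h" shows "smooth_at A2 q (\<lambda>q. h (p, q))"
proof -
  from assms obtain W where W: "open W" "(p, q) \<in> W" "smooth_fun_on P W h"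
    unfolding smooth_at_def by blast
  then show ?thesis
    using smooth_fun_on_slice2[OF W(1,3), of p] unfolding smooth_at_def by blast
qed

text \<open>From left to right this is restriction to a slice. The equivalence makes the cutoffs at
  non-smooth functions agree between a factor and the product.\<close>

lemma smooth_at_fst: "smooth_at P z (\<lambda>z. a (fst z)) \<longleftrightarrow> smooth_at A1 (fst z) a"
proof
  assume "smooth_at A1 (fst z) a"
  then obtain W where "open W" "fst z \<in> W" "smooth_fun_on A1 W a" unfolding smooth_at_def by blast
  then have "open (W \<times> (UNIV :: 'b set))" "z \<in> W \<times> UNIV" "smooth_fun_on P (W \<times> UNIV) (\<lambda>z. a (fst z))"
    using smooth_fun_on_fst by (auto intro: open_Times simp: mem_Times_iff)
  then show "smooth_at P z (\<lambda>z. a (fst z))" unfolding smooth_at_def by blast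
qed (use smooth_at_slice1[of "fst z" "snd z" "\<lambda>z. a (fst z)"] in simp)

lemma smooth_at_snd: "smooth_at P z (\<lambda>z. a (snd z)) \<longleftrightarrow> smooth_at A2 (snd z) a"
proof
  assume "smooth_at A2 (snd z) a"
  then obtain W where "open W" "snd z \<in> W" "smooth_fun_on A2 W a" unfolding smooth_at_def by blast
  then have "open ((UNIV :: 'a set) \<times> W)" "z \<in> UNIV \<times> W" "smooth_fun_on P (UNIV \<times> W) (\<lambda>z. a (snd z))"
    using smooth_fun_on_snd by (auto intro: open_Times simp: mem_Times_iff)
  then show "smooth_at P z (\<lambda>z. a (snd z))" unfolding smooth_at_def by blast
qed (use smooth_at_slice2[of "fst z" "snd z" "\<lambda>z. a (snd z)"] in simp)

section \<open>Tangent vectors and lifted fields on a product\<close>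

lemma pushforward_chart_vec:
  fixes w :: "'e1 \<times> 'e2"
  assumes C: "(U, \<phi>) \<in> A1" "p \<in> U" "(V, \<psi>) \<in> A2" "q \<in> V"
  defines "T \<equiv> chart_vec P (U \<times> V) (map_prod \<phi> \<psi>) (p, q) w"
  shows "pushforward A1 fst (p, q) T = chart_vec A1 U \<phi> p (fst w)"
    and "pushforward A2 snd (p, q) T = chart_vec A2 V \<psi> q (snd w)"
proof -
  let ?S = "\<phi> ` U \<times> \<psi> ` V"
  have o: "open ?S" "(\<phi> p, \<psi> q) \<in> ?S"
    using M1.chart_homeomorphism(2)[OF C(1)] M2.chart_homeomorphism(2)[OF C(3)] C by (auto intro: open_Times)
  show "pushforward A1 fst (p, q) T = chart_vec A1 U \<phi> p (fst w)"
  proof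
    fix a
    show "pushforward A1 fst (p, q) T a = chart_vec A1 U \<phi> p (fst w) a"
    proof (cases "smooth_at A1 p a")
      case True
      let ?D = "frechet_derivative (a \<circ> inv_into U \<phi>) (at (\<phi> p))"
      have "((\<lambda>z. (a \<circ> inv_into U \<phi>) (fst z)) has_derivative (\<lambda>z. ?D (fst z))) (at (\<phi> p, \<psi> q))"
        using M1.smooth_at_has_derivative[OF C(1,2) True]
        by (intro has_derivative_compose[OF has_derivative_fst[OF has_derivative_ident]]) (simp only: fst_conv)
      then have "(((a \<circ> fst) \<circ> inv_into (U \<times> V) (map_prod \<phi> \<psi>)) has_derivative (\<lambda>z. ?D (fst z))) (at (\<phi> p, \<psi> q))"
        by (rule has_derivative_transform_within_open[OF _ o]) (auto simp: inv_product_chart C)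
      from frechet_derivative_at[OF this, symmetric] True show ?thesis
        using smooth_at_fst[of "(p, q)" a] by (simp add: pushforward_def T_def chart_vec_def comp_def)
    qed (simp add: pushforward_def chart_vec_def)
  qed
  show "pushforward A2 snd (p, q) T = chart_vec A2 V \<psi> q (snd w)"
  proof
    fix a
    show "pushforward A2 snd (p, q) T a = chart_vec A2 V \<psi> q (snd w) a"
    proof (cases "smooth_at A2 q a")
      case True
      let ?D = "frechet_derivative (a \<circ> inv_into V \<psi>) (at (\<psi> q))"
      have "((\<lambda>z. (a \<circ> inv_into V \<psi>) (snd z)) has_derivative (\<lambda>z. ?D (snd z))) (at (\<phi> p, \<psi> q))"
        using M2.smooth_at_has_derivative[OF C(3,4) True]
        by (intro has_derivative_compose[OF has_derivative_snd[OF has_derivative_ident]]) (simp only: snd_conv)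
      then have "(((a \<circ> snd) \<circ> inv_into (U \<times> V) (map_prod \<phi> \<psi>)) has_derivative (\<lambda>z. ?D (snd z))) (at (\<phi> p, \<psi> q))"
        by (rule has_derivative_transform_within_open[OF _ o]) (auto simp: inv_product_chart C)
      from frechet_derivative_at[OF this, symmetric] True show ?thesis
        using smooth_at_snd[of "(p, q)" a] by (simp add: pushforward_def T_def chart_vec_def comp_def)
    qed (simp add: pushforward_def chart_vec_def)
  qed
qed

lemma product_tangent_vec_cases:
  assumes "T \<in> tangent_space P z"
  obtains U \<phi> V \<psi> w where "(U, \<phi>) \<in> A1" "fst z \<in> U" "(V, \<psi>) \<in> A2" "snd z \<in> V"
    "T = chart_vec P (U \<times> V) (map_prod \<phi> \<psi>) z w"
proof -
  obtain U \<phi> V \<psi> where C: "(U, \<phi>) \<in> A1" "fst z \<in> U" "(V, \<psi>) \<in> A2" "snd z \<in> V"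
    using M1.chart_at[of "fst z"] M2.chart_at[of "snd z"] by metis
  then show ?thesis
    using that assms M.tangent_space_chart[OF product_chart[OF C(1,3)], of z] by (auto simp: mem_Times_iff)
qed

lemma pushforward_in_tangent_space:
  assumes "T \<in> tangent_space P z"
  shows "pushforward A1 fst z T \<in> tangent_space A1 (fst z)"
    and "pushforward A2 snd z T \<in> tangent_space A2 (snd z)"
proof -
  from assms obtain U \<phi> V \<psi> w where C: "(U, \<phi>) \<in> A1" "fst z \<in> U" "(V, \<psi>) \<in> A2" "snd z \<in> V"
    "T = chart_vec P (U \<times> V) (map_prod \<phi> \<psi>) z w" by (rule product_tangent_vec_cases)
  then show "pushforward A1 fst z T \<in> tangent_space A1 (fst z)"
    and "pushforward A2 snd z T \<in> tangent_space A2 (snd z)"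
    using pushforward_chart_vec[OF C(1-4), of w] M1.chart_vec_in_tangent_space[OF C(1,2)]
      M2.chart_vec_in_tangent_space[OF C(3,4)] by simp_all
qed

text \<open>The guard in \<open>pushforward\<close> changes nothing for tangent vectors: if
  \<open>a\<close> is not smooth, neither is its pullback, and \<open>T\<close> vanishes there
  already.\<close>

lemma pushforward_apply:
  assumes "T \<in> tangent_space P z"
  shows "pushforward A1 fst z T a = T (\<lambda>z. a (fst z))"
    and "pushforward A2 snd z T b = T (\<lambda>z. b (snd z))"
  using M.tangent_vec_not_smooth[OF assms, of "\<lambda>z. a (fst z)"] smooth_at_fst[of z a]
    M.tangent_vec_not_smooth[OF assms, of "\<lambda>z. b (snd z)"] smooth_at_snd[of z b]
  by (auto simp: pushforward_def comp_def)

text \<open>Each coordinate of a product chart is a function of one factor, so such functions detect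
  every component of a tangent vector.\<close>

lemma product_tangent_vec_eqI:
  assumes T: "T \<in> tangent_space P z" "T' \<in> tangent_space P z"
    and 1: "\<And>a. T (\<lambda>z. a (fst z)) = T' (\<lambda>z. a (fst z))"
    and 2: "\<And>b. T (\<lambda>z. b (snd z)) = T' (\<lambda>z. b (snd z))"
  shows "T = T'"
proof -
  from T(1) obtain U \<phi> V \<psi> w where C: "(U, \<phi>) \<in> A1" "fst z \<in> U" "(V, \<psi>) \<in> A2" "snd z \<in> V"
    and w: "T = chart_vec P (U \<times> V) (map_prod \<phi> \<psi>) z w" by (rule product_tangent_vec_cases)
  then obtain w' where w': "T' = chart_vec P (U \<times> V) (map_prod \<phi> \<psi>) z w'"
    using T(2) M.tangent_space_chart[OF product_chart[OF C(1,3)], of z] by (auto simp: mem_Times_iff)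
  have "pushforward A1 fst z T = pushforward A1 fst z T'" "pushforward A2 snd z T = pushforward A2 snd z T'"
    using T 1 2 by (simp_all add: fun_eq_iff pushforward_apply)
  then have "chart_vec A1 U \<phi> (fst z) (fst w) = chart_vec A1 U \<phi> (fst z) (fst w')"
    "chart_vec A2 V \<psi> (snd z) (snd w) = chart_vec A2 V \<psi> (snd z) (snd w')"
    using pushforward_chart_vec[OF C, of w] pushforward_chart_vec[OF C, of w'] w w' by simp_all
  then have "fst w \<bullet> b = fst w' \<bullet> b" "snd w \<bullet> c = snd w' \<bullet> c" for b c
    using M1.chart_vec_coord[OF C(1,2), of "fst w" b] M1.chart_vec_coord[OF C(1,2), of "fst w'" b]
      M2.chart_vec_coord[OF C(3,4), of "snd w" c] M2.chart_vec_coord[OF C(3,4), of "snd w'" c] by simp_all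
  then have "fst w = fst w'" "snd w = snd w'" by (auto intro: euclidean_eqI)
  then have "w = w'" by (simp add: prod_eq_iff)
  then show ?thesis using w w' by simp
qed

text \<open>The derivative in direction \<open>(x, y)\<close> is the sum of those in directions
  \<open>(x, 0)\<close> and \<open>(0, y)\<close>, which are the derivatives of the two
  slices.\<close>

lemma lift_chart:
  assumes C: "(U, \<phi>) \<in> A1" "p \<in> U" "(V, \<psi>) \<in> A2" "q \<in> V"
    and X: "X p = chart_vec A1 U \<phi> p x" and Y: "Y q = chart_vec A2 V \<psi> q y"
  shows "lift A1 A2 X Y (p, q) = chart_vec P (U \<times> V) (map_prod \<phi> \<psi>) (p, q) (x, y)"
proof
  fix h
  show "lift A1 A2 X Y (p, q) h = chart_vec P (U \<times> V) (map_prod \<phi> \<psi>) (p, q) (x, y) h"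
  proof (cases "smooth_at P (p, q) h")
    case True
    let ?H = "h \<circ> inv_into (U \<times> V) (map_prod \<phi> \<psi>)"
    let ?D = "frechet_derivative ?H (at (\<phi> p, \<psi> q))"
    have "(?H has_derivative ?D) (at (map_prod \<phi> \<psi> (p, q)))"
      using M.smooth_at_has_derivative[OF product_chart[OF C(1,3)] _ True] C by simp
    then have D: "(?H has_derivative ?D) (at (\<phi> p, \<psi> q))" by simp
    have "((\<lambda>x. ?H (x, \<psi> q)) has_derivative (\<lambda>x. ?D (x, 0))) (at (\<phi> p))"
      by (intro has_derivative_compose[OF has_derivative_Pair[OF has_derivative_ident has_derivative_const] D])
    then have "(((\<lambda>p. h (p, q)) \<circ> inv_into U \<phi>) has_derivative (\<lambda>x. ?D (x, 0))) (at (\<phi> p))"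
      by (rule has_derivative_transform_within_open[OF _ M1.chart_homeomorphism(2)[OF C(1)]])
        (use C in \<open>auto simp: inv_product_chart\<close>)
    from frechet_derivative_at[OF this, symmetric]
    have 1: "X p (\<lambda>p. h (p, q)) = ?D (x, 0)"
      using smooth_at_slice1[OF True] by (simp add: X chart_vec_def)
    have "((\<lambda>x. ?H (\<phi> p, x)) has_derivative (\<lambda>x. ?D (0, x))) (at (\<psi> q))"
      by (intro has_derivative_compose[OF has_derivative_Pair[OF has_derivative_const has_derivative_ident] D])
    then have "(((\<lambda>q. h (p, q)) \<circ> inv_into V \<psi>) has_derivative (\<lambda>x. ?D (0, x))) (at (\<psi> q))"
      by (rule has_derivative_transform_within_open[OF _ M2.chart_homeomorphism(2)[OF C(3)]])
        (use C in \<open>auto simp: inv_product_chart\<close>)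
    from frechet_derivative_at[OF this, symmetric]
    have 2: "Y q (\<lambda>q. h (p, q)) = ?D (0, y)"
      using smooth_at_slice2[OF True] by (simp add: Y chart_vec_def)
    have "?D (x, y) = ?D (x, 0) + ?D (0, y)"
      using linear_add[OF has_derivative_linear[OF D], of "(x, 0)" "(0, y)"] by simp
    then show ?thesis using True 1 2 by (simp add: lift_def chart_vec_def)
  qed (simp add: lift_def chart_vec_def)
qed

lemma vector_field_lift:
  assumes X: "vector_field A1 X" and Y: "vector_field A2 Y"
  shows "vector_field P (lift A1 A2 X Y)"
proof (rule M.vector_fieldI)
  fix z :: "'a \<times> 'b"
  obtain U \<phi> V \<psi> where C: "(U, \<phi>) \<in> A1" "fst z \<in> U" "(V, \<psi>) \<in> A2" "snd z \<in> V"
    using M1.chart_at[of "fst z"] M2.chart_at[of "snd z"] by metis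
  obtain \<xi> where \<xi>: "smooth_on (\<phi> ` U) \<xi>" "\<And>p. p \<in> U \<Longrightarrow> X p = chart_vec A1 U \<phi> p (\<xi> (\<phi> p))"
    using M1.vector_field_chart[OF X C(1)] by metis
  obtain \<eta> where \<eta>: "smooth_on (\<psi> ` V) \<eta>" "\<And>q. q \<in> V \<Longrightarrow> Y q = chart_vec A2 V \<psi> q (\<eta> (\<psi> q))"
    using M2.vector_field_chart[OF Y C(3)] by metis
  have o: "open (\<phi> ` U \<times> \<psi> ` V)" "open (U \<times> V)"
    using M1.chart_homeomorphism[OF C(1)] M2.chart_homeomorphism[OF C(3)] by (auto intro: open_Times)
  have "smooth_on (\<phi> ` U \<times> \<psi> ` V) (\<lambda>z. \<xi> (fst z))" "smooth_on (\<phi> ` U \<times> \<psi> ` V) (\<lambda>z. \<eta> (snd z))"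
    using M1.chart_homeomorphism(2)[OF C(1)] M2.chart_homeomorphism(2)[OF C(3)]
    by (intro smooth_on_Times_fst \<xi>(1), simp_all) (intro smooth_on_Times_snd \<eta>(1))
  from smooth_on_Pair[OF o(1) this]
  have "smooth_on (map_prod \<phi> \<psi> ` (U \<times> V)) (\<lambda>z. (\<xi> (fst z), \<eta> (snd z)))" by (simp add: map_prod_image)
  moreover have "lift A1 A2 X Y (p, q) = chart_vec P (U \<times> V) (map_prod \<phi> \<psi>) (p, q) (\<xi> (\<phi> p), \<eta> (\<psi> q))"
    if "p \<in> U" "q \<in> V" for p q
    by (rule lift_chart) (use C that \<xi>(2) \<eta>(2) in auto)
  ultimately show "\<exists>U \<phi> N \<xi>. (U, \<phi>) \<in> P \<and> open N \<and> z \<in> N \<and> N \<subseteq> U \<and>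
      smooth_on (\<phi> ` N) \<xi> \<and> (\<forall>p\<in>N. lift A1 A2 X Y p = chart_vec P U \<phi> p (\<xi> (\<phi> p)))"
    using product_chart[OF C(1,3)] C o(2)
    by (intro exI[of _ "U \<times> V"] exI[of _ "map_prod \<phi> \<psi>"] exI[of _ "\<lambda>z. (\<xi> (fst z), \<eta> (snd z))"])
      (auto simp: mem_Times_iff)
qed

text \<open>The other summand differentiates a constant. At a non-smooth \<open>a\<close> or
  \<open>b\<close> both sides are 0.\<close>

lemma lift_apply:
  assumes "vector_field A1 X" "vector_field A2 Y"
  shows "lift A1 A2 X Y z (\<lambda>z. a (fst z)) = X (fst z) a"
    and "lift A1 A2 X Y z (\<lambda>z. b (snd z)) = Y (snd z) b"
  using M1.vector_field_tangent[OF assms(1), of "fst z"] M2.vector_field_tangent[OF assms(2), of "snd z"]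
  by (auto simp: lift_def smooth_at_fst smooth_at_snd
      M1.tangent_vec_const M2.tangent_vec_const M1.tangent_vec_not_smooth M2.tangent_vec_not_smooth)

lemma pushforward_lift:
  assumes "vector_field A1 X" "vector_field A2 Y"
  shows "pushforward A1 fst z (lift A1 A2 X Y z) = X (fst z)"
    and "pushforward A2 snd z (lift A1 A2 X Y z) = Y (snd z)"
  using pushforward_apply[OF M.vector_field_tangent[OF vector_field_lift[OF assms]], of z]
  by (auto simp: fun_eq_iff lift_apply[OF assms])

lemma lift_zero: "lift A1 A2 vf_zero vf_zero = vf_zero"
  by (simp add: lift_def vf_zero_def fun_eq_iff)

lemma vector_field_eqI:
  assumes "vector_field P S" "vector_field P T"
    and "\<And>z a. S z (\<lambda>z. a (fst z)) = T z (\<lambda>z. a (fst z))"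
    and "\<And>z b. S z (\<lambda>z. b (snd z)) = T z (\<lambda>z. b (snd z))"
  shows "S = T"
  by (rule ext, rule product_tangent_vec_eqI) (use assms M.vector_field_tangent in auto)

text \<open>Testing on functions of one factor only avoids the symmetry of second derivatives.\<close>

lemma lie_bracket_lift:
  assumes X: "vector_field A1 X" "vector_field A1 X'" and Y: "vector_field A2 Y" "vector_field A2 Y'"
    and B: "vector_field A1 (lie_bracket A1 X X')" "vector_field A2 (lie_bracket A2 Y Y')"
      "vector_field P (lie_bracket P (lift A1 A2 X Y) (lift A1 A2 X' Y'))"
  shows "lie_bracket P (lift A1 A2 X Y) (lift A1 A2 X' Y') =
    lift A1 A2 (lie_bracket A1 X X') (lie_bracket A2 Y Y')"
proof (rule vector_field_eqI)
  fix z a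
  show "lie_bracket P (lift A1 A2 X Y) (lift A1 A2 X' Y') z (\<lambda>z. a (fst z)) =
      lift A1 A2 (lie_bracket A1 X X') (lie_bracket A2 Y Y') z (\<lambda>z. a (fst z))"
    using lift_apply(1)[OF X(1) Y(1), of z "\<lambda>p. X' p a"] lift_apply(1)[OF X(2) Y(2), of z "\<lambda>p. X p a"]
    by (simp add: lift_apply X Y B) (simp add: lie_bracket_def smooth_at_fst lift_apply X Y)
next
  fix z b
  show "lie_bracket P (lift A1 A2 X Y) (lift A1 A2 X' Y') z (\<lambda>z. b (snd z)) =
      lift A1 A2 (lie_bracket A1 X X') (lie_bracket A2 Y Y') z (\<lambda>z. b (snd z))"
    using lift_apply(2)[OF X(1) Y(1), of z "\<lambda>q. Y' q b"] lift_apply(2)[OF X(2) Y(2), of z "\<lambda>q. Y q b"]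
    by (simp add: lift_apply X Y B) (simp add: lie_bracket_def smooth_at_snd lift_apply X Y)
qed (use B vector_field_lift in auto)

text \<open>Tailored to the warped metric on lifts: \<open>a\<close> and \<open>b\<close> become
  metric functions of the two factors, and \<open>c\<close> becomes the square of the warping
  function.\<close>

lemma lift_apply_warped:
  assumes X: "vector_field A1 X" and Y: "vector_field A2 Y"
    and s: "smooth_fun_on A1 UNIV a" "smooth_fun_on A1 UNIV c" "smooth_fun_on A2 UNIV b"
  shows "lift A1 A2 X Y z (\<lambda>z. a (fst z) + c (fst z) * b (snd z)) =
    X (fst z) a + X (fst z) c * b (snd z) + c (fst z) * Y (snd z) b"
proof -
  have T: "lift A1 A2 X Y z \<in> tangent_space P z"
    by (rule M.vector_field_tangent[OF vector_field_lift[OF X Y]])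
  have a: "smooth_at P z (\<lambda>z. a (fst z))" "smooth_at P z (\<lambda>z. c (fst z))" "smooth_at P z (\<lambda>z. b (snd z))"
    using M1.smooth_at_UNIV M2.smooth_at_UNIV s by (auto simp: smooth_at_fst smooth_at_snd)
  have "smooth_at P z (\<lambda>z. c (fst z) * b (snd z))"
    using M.smooth_at_binary[OF M.smooth_fun_on_mult a(2,3)] by simp
  from M.tangent_vec_add[OF T a(1) this] M.tangent_vec_mult[OF T a(2,3)]
  show ?thesis by (simp add: lift_apply X Y)
qed

end

section \<open>Metrics and connections\<close>

text \<open>Isolates the algebra behind the Koszul formula, so that the formula applies to the
  warped metric after a check on tangent vectors alone.\<close>

definition symmetric_bilinear ::
  "('a::topological_space, 'e::euclidean_space) atlas \<Rightarrow> 'a metric \<Rightarrow> bool" where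
  "symmetric_bilinear A g \<longleftrightarrow>
     (\<forall>p. \<forall>u\<in>tangent_space A p. \<forall>v\<in>tangent_space A p. g p u v = g p v u) \<and>
     (\<forall>p. \<forall>u\<in>tangent_space A p. \<forall>v\<in>tangent_space A p. \<forall>w\<in>tangent_space A p. \<forall>a b.
        g p (\<lambda>h. a * u h + b * v h) w = a * g p u w + b * g p v w)"

lemma pseudo_riemannian_metric_bilinear:
  "pseudo_riemannian_metric A g \<Longrightarrow> symmetric_bilinear A g"
  by (simp add: pseudo_riemannian_metric_def symmetric_bilinear_def)

lemma levi_civita_affine: "levi_civita A g D \<Longrightarrow> affine_connection A D"
  by (simp add: levi_civita_def)

lemma levi_civita_torsion:
  "levi_civita A g D \<Longrightarrow> vector_field A X \<Longrightarrow> vector_field A Y \<Longrightarrow>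
    lie_bracket A X Y = vf_diff (D X Y) (D Y X)"
  by (simp add: levi_civita_def)

lemma levi_civita_compatible:
  "levi_civita A g D \<Longrightarrow> vector_field A X \<Longrightarrow> vector_field A Y \<Longrightarrow> vector_field A Z \<Longrightarrow>
    X p (metric_fun g Y Z) = metric_fun g (D X Y) Z p + metric_fun g Y (D X Z) p"
  by (simp add: levi_civita_def)

lemma connection_vector_field:
  "affine_connection A D \<Longrightarrow> vector_field A X \<Longrightarrow> vector_field A Y \<Longrightarrow> vector_field A (D X Y)"
  by (simp add: affine_connection_def)

lemma connection_scale_left:
  "affine_connection A D \<Longrightarrow> smooth_fun_on A UNIV a \<Longrightarrow> vector_field A X \<Longrightarrow> vector_field A Y \<Longrightarrow>
    D (vf_scale a X) Y = vf_scale a (D X Y)"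
  by (simp add: affine_connection_def)

lemma connection_scale_right:
  "affine_connection A D \<Longrightarrow> smooth_fun_on A UNIV a \<Longrightarrow> vector_field A X \<Longrightarrow> vector_field A Y \<Longrightarrow>
    D X (vf_scale a Y) = vf_add (vf_scale (\<lambda>p. X p a) Y) (vf_scale a (D X Y))"
  by (simp add: affine_connection_def)

context smooth_atlas
begin

lemma connection_zero_left:
  assumes "affine_connection A D" "vector_field A Y"
  shows "D vf_zero Y = vf_zero"
proof -
  have "vf_scale (\<lambda>p. 0) vf_zero = (vf_zero :: 'a vfield)" by (simp add: vf_scale_def vf_zero_def)
  then have "D vf_zero Y = vf_scale (\<lambda>p. 0) (D vf_zero Y)"
    using connection_scale_left[OF assms(1) smooth_fun_on_const vector_field_zero assms(2), of 0] by simp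
  then show ?thesis by (simp add: vf_scale_def vf_zero_def)
qed

text \<open>Torsion-freeness exhibits the bracket as a difference of two covariant derivatives. A
  direct proof would have to cancel second derivatives in a chart.\<close>

lemma vector_field_lie_bracket:
  "levi_civita A g D \<Longrightarrow> vector_field A X \<Longrightarrow> vector_field A Y \<Longrightarrow> vector_field A (lie_bracket A X Y)"
  by (simp add: levi_civita_torsion vector_field_diff connection_vector_field levi_civita_affine)

lemma vector_field_apply_const: "vector_field A X \<Longrightarrow> X p (\<lambda>p. c) = 0"
  using tangent_vec_const vector_field_tangent by blast

lemma lie_bracket_zero:
  assumes "vector_field A X"
  shows "lie_bracket A vf_zero X = vf_zero" "lie_bracket A X vf_zero = vf_zero"
  using assms by (auto simp: lie_bracket_def vf_zero_def fun_eq_iff vector_field_apply_const)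

context
  fixes g :: "'a metric"
  assumes g: "symmetric_bilinear A g"
begin

lemma metric_fun_sym: "vector_field A X \<Longrightarrow> vector_field A Y \<Longrightarrow> metric_fun g X Y = metric_fun g Y X"
  using g vector_field_tangent by (auto simp: symmetric_bilinear_def metric_fun_def)

lemma metric_lincomb:
  assumes "u \<in> tangent_space A p" "v \<in> tangent_space A p" "w \<in> tangent_space A p"
  shows "g p (\<lambda>h. a * u h + b * v h) w = a * g p u w + b * g p v w"
  using g assms unfolding symmetric_bilinear_def by blast

lemma metric_scale:
  assumes "u \<in> tangent_space A p" "w \<in> tangent_space A p"
  shows "g p (\<lambda>h. a * u h) w = a * g p u w"
  using metric_lincomb[OF assms(1,1,2), of a 0] by simp

lemma metric_fun_scale:
  assumes "vector_field A X" "vector_field A Y"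
  shows "metric_fun g (vf_scale a X) Y p = a p * metric_fun g X Y p"
  using metric_scale assms by (simp add: metric_fun_def vf_scale_def vector_field_tangent)

lemma metric_fun_diff:
  assumes "vector_field A X" "vector_field A Y" "vector_field A Z"
  shows "metric_fun g (vf_diff X Y) Z p = metric_fun g X Z p - metric_fun g Y Z p"
  using metric_lincomb[of "X p" p "Y p" "Z p" 1 "-1"] assms
  by (simp add: metric_fun_def vf_diff_def vector_field_tangent)

lemma metric_fun_zero:
  assumes "vector_field A X"
  shows "metric_fun g vf_zero X = (\<lambda>p. 0)" "metric_fun g X vf_zero = (\<lambda>p. 0)"
proof -
  have "metric_fun g vf_zero X p = 0" for p
    using metric_fun_scale[OF vector_field_zero assms, of "\<lambda>p. 0" p]
    by (simp add: vf_scale_def vf_zero_def)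
  then show "metric_fun g vf_zero X = (\<lambda>p. 0)" by auto
  then show "metric_fun g X vf_zero = (\<lambda>p. 0)"
    using metric_fun_sym[OF assms vector_field_zero] by simp
qed

text \<open>Torsion-freeness turns brackets into differences of covariant derivatives, and
  compatibility splits the derivatives of the metric; everything cancels except two copies of the
  product on the left. As the right-hand side is free of \<open>D\<close>, it computes the
  connection on lifts.\<close>

lemma koszul:
  assumes D: "levi_civita A g D" and X: "vector_field A X" and Y: "vector_field A Y" and Z: "vector_field A Z"
  shows "2 * metric_fun g (D X Y) Z p =
    X p (metric_fun g Y Z) + Y p (metric_fun g X Z) - Z p (metric_fun g X Y)
    + metric_fun g (lie_bracket A X Y) Z p - metric_fun g (lie_bracket A X Z) Y p
    - metric_fun g (lie_bracket A Y Z) X p"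
proof -
  note V = connection_vector_field[OF levi_civita_affine[OF D]]
  show ?thesis
    using metric_fun_sym[OF Y V[OF X Z]] metric_fun_sym[OF X V[OF Y Z]] metric_fun_sym[OF X V[OF Z Y]]
    by (simp add: levi_civita_torsion[OF D] levi_civita_compatible[OF D] metric_fun_diff V X Y Z)
qed

end

text \<open>Nondegeneracy of the metric quantifies over tangent vectors, while identities between
  fields supply only values of global fields; \<open>tangent_vec_extend\<close> makes the two
  equivalent.\<close>

lemma metric_nondegenerate:
  assumes g: "pseudo_riemannian_metric A g" and T: "u \<in> tangent_space A p" "v \<in> tangent_space A p"
    and eq: "\<And>X. vector_field A X \<Longrightarrow> g p u (X p) = g p v (X p)"
  shows "u = v"
proof -
  let ?w = "\<lambda>h. 1 * u h + (- 1) * v h"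
  have "g p ?w t = 0" if t: "t \<in> tangent_space A p" for t
  proof -
    obtain X where "vector_field A X" "X p = t" using tangent_vec_extend[OF t] by blast
    then show ?thesis
      using metric_lincomb[OF pseudo_riemannian_metric_bilinear[OF g] T t, of 1 "-1"] eq by fastforce
  qed
  moreover have "?w \<in> tangent_space A p" by (rule tangent_space_lincomb[OF T])
  ultimately have "?w = (\<lambda>h. 0)" using g unfolding pseudo_riemannian_metric_def by blast
  then show ?thesis by (simp add: fun_eq_iff)
qed

text \<open>A Euclidean space has a basis vector; \<open>h\<close> is the matching coordinate
  function.\<close>

lemma vector_field_nonzero: obtains X h where "vector_field A X" "X p h = 1"
proof -
  obtain U \<phi> where C: "(U, \<phi>) \<in> A" "p \<in> U" by (rule chart_at)
  obtain b :: 'e where b: "b \<in> Basis" using nonempty_Basis by blast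
  obtain X where "vector_field A X" "X p = chart_vec A U \<phi> p b"
    using tangent_vec_extend[OF chart_vec_in_tangent_space[OF C]] by metis
  then show ?thesis using that chart_vec_coord[OF C, of b b] b by (simp add: inner_Basis)
qed

lemma metric_nonzero:
  assumes g: "pseudo_riemannian_metric A g"
  obtains X Y where "vector_field A X" "vector_field A Y" "metric_fun g X Y p \<noteq> 0"
proof -
  obtain X h where X: "vector_field A X" "X p h = 1" by (rule vector_field_nonzero)
  have "\<exists>Y. vector_field A Y \<and> metric_fun g X Y p \<noteq> 0"
  proof (rule ccontr)
    assume "\<not> ?thesis"
    then have "X p = vf_zero p"
      using metric_fun_zero(1)[OF pseudo_riemannian_metric_bilinear[OF g]]
      by (intro metric_nondegenerate[OF g vector_field_tangent[OF X(1)] vector_field_tangent[OF vector_field_zero]])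
        (auto simp: metric_fun_def fun_eq_iff)
    then show False using X(2) by (simp add: vf_zero_def)
  qed
  then show ?thesis using that X(1) by blast
qed

text \<open>Two dimensions leave a direction outside the span of \<open>v\<close>. The conclusion
  also covers \<open>v = 0\<close> and is shaped for comparing coefficients in an identity between
  multiples of \<open>v\<close> and of \<open>X p\<close>.\<close>

lemma independent_vector_field:
  assumes dim: "2 \<le> DIM('e)" and v: "v \<in> tangent_space A p"
  obtains X where "vector_field A X" "\<And>a b. (\<And>h. a * v h = b * X p h) \<Longrightarrow> b = 0"
proof -
  from v obtain U \<phi> x where C: "(U, \<phi>) \<in> A" "p \<in> U" and x: "v = chart_vec A U \<phi> p x"
    by (rule tangent_vec_cases)
  have "dim {x} \<le> 1" using dim_le_card[of "{x}" "{x}"] by (simp add: span_superset)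
  then have "span {x} \<noteq> UNIV" using dim by (metis dim_span dim_UNIV not_less_eq_eq numeral_2_eq_2 One_nat_def order_trans)
  then obtain y where y: "y \<notin> span {x}" by blast
  obtain X where X: "vector_field A X" "X p = chart_vec A U \<phi> p y"
    using tangent_vec_extend[OF chart_vec_in_tangent_space[OF C]] by metis
  have "b = 0" if ab: "\<And>h. a * v h = b * X p h" for a b
  proof (rule ccontr)
    assume "b \<noteq> 0"
    have "a * (x \<bullet> c) = b * (y \<bullet> c)" for c
      using ab[of "\<lambda>p. \<phi> p \<bullet> c"] by (simp add: x X(2) chart_vec_coord[OF C])
    then have "(a *\<^sub>R x) \<bullet> c = (b *\<^sub>R y) \<bullet> c" for c by simp
    then have "a *\<^sub>R x = b *\<^sub>R y" by (blast intro: euclidean_eqI)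
    then have "y = (a / b) *\<^sub>R x" using \<open>b \<noteq> 0\<close> by (simp add: eq_vector_fraction_iff)
    then show False using y by (simp add: span_base span_scale)
  qed
  then show ?thesis using that X(1) by blast
qed

text \<open>Differentiating \<open>\<phi> \<zeta>\<close> along \<open>Y\<close> and
  \<open>\<phi> Y\<close> along \<open>\<zeta>\<close> leaves, beside the derivatives of
  \<open>\<phi>\<close>, the terms \<open>\<phi>\<^sup>2 Y\<close> and
  \<open>- \<phi> (D \<zeta> Y)\<close>. The bracket term
  \<open>\<phi> (D \<zeta> Y - \<phi> Y)\<close> cancels both.\<close>

lemma riemann_concircular:
  assumes D: "levi_civita A g D" and Z: "vector_field A \<zeta>" "\<And>X. vector_field A X \<Longrightarrow> D X \<zeta> = vf_scale \<phi> X"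
    and \<phi>: "smooth_fun_on A UNIV \<phi>" and Y: "vector_field A Y"
  shows "riemann A D \<zeta> Y \<zeta> p h = Y p \<phi> * \<zeta> p h - \<zeta> p \<phi> * Y p h"
proof -
  note aff = levi_civita_affine[OF D]
  show ?thesis
    unfolding riemann_def
    by (simp add: Z Y vector_field_lie_bracket[OF D] connection_scale_right[OF aff \<phi>])
      (simp add: levi_civita_torsion[OF D Z(1) Y] Z Y vf_add_def vf_diff_def vf_scale_def algebra_simps)
qed

section \<open>The base of the warped product\<close>

text \<open>With \<open>u = 1 - \<phi>\<close> and \<open>s = g(\<zeta>, \<zeta>)\<close>, the hypotheses yield \<open>u = - k s\<close> and
  \<open>u (s X(f) - f g(X, \<zeta>)) = 0\<close>. Differentiating the latter and comparing with the Hessian of \<open>f\<close>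
  gives \<open>(2\<phi> - 1) (g(X, \<zeta>) g(Y, \<zeta>) - s g(X, Y)) = 0\<close> where \<open>u\<close> does not vanish. As \<open>g\<close> has rank
  at least two, \<open>\<phi> = 1/2\<close> there, which is incompatible with \<open>\<zeta>(\<phi>) = u\<close>. Hence \<open>u = 0\<close>
  everywhere. In this way \<open>k\<close> is never differentiated, and Schur's lemma is avoided.\<close>

lemma concircular_gradient_imp_flat:
  assumes g: "pseudo_riemannian_metric A g" and D: "levi_civita A g D" and dim: "2 \<le> DIM('e)"
    and f: "smooth_fun_on A UNIV f" "\<And>p. 0 < f p"
    and Z: "vector_field A \<zeta>" "\<And>X. vector_field A X \<Longrightarrow> D X \<zeta> = vf_scale \<phi> X"
    and \<phi>: "smooth_fun_on A UNIV \<phi>" and \<zeta>f: "\<And>p. \<zeta> p f = f p"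
    and hess: "\<And>X Y p. vector_field A X \<Longrightarrow> vector_field A Y \<Longrightarrow>
      X p (\<lambda>q. Y q f) = D X Y p f - k p * f p * metric_fun g X Y p"
    and curv: "\<And>Y p h. vector_field A Y \<Longrightarrow>
      riemann A D \<zeta> Y \<zeta> p h = k p * (metric_fun g \<zeta> \<zeta> p * Y p h - metric_fun g Y \<zeta> p * \<zeta> p h)"
  shows "k p = 0"
proof -
  note bil = pseudo_riemannian_metric_bilinear[OF g]
  note V = connection_vector_field[OF levi_civita_affine[OF D]]
  define s where "s = metric_fun g \<zeta> \<zeta>"
  define gz where "gz X = metric_fun g X \<zeta>" for X
  have metric_smooth: "smooth_fun_on A UNIV (metric_fun g X Y)" if "vector_field A X" "vector_field A Y" for X Y
    using g that by (simp add: pseudo_riemannian_metric_def)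
  have s_smooth: "smooth_fun_on A UNIV s" unfolding s_def by (intro metric_smooth Z)
  have gz_smooth: "smooth_fun_on A UNIV (gz X)" if "vector_field A X" for X
    unfolding gz_def by (intro metric_smooth Z that)
  have \<zeta>\<phi>: "\<zeta> p \<phi> = - k p * s p" for p
  proof -
    \<comment> \<open>Two expressions for the same curvature are compared. As \<open>Y p\<close> is
      independent of \<open>\<zeta> p\<close>, its coefficients must agree.\<close>
    obtain Y where Y: "vector_field A Y" "\<And>a b. (\<And>h. a * \<zeta> p h = b * Y p h) \<Longrightarrow> b = 0"
      using independent_vector_field[OF dim vector_field_tangent[OF Z(1)]] by metis
    have "riemann A D \<zeta> Y \<zeta> p h = Y p \<phi> * \<zeta> p h - \<zeta> p \<phi> * Y p h" for h
      by (rule riemann_concircular[OF D Z(1) _ \<phi> Y(1)]) (rule Z(2))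
    then have "(Y p \<phi> + k p * gz Y p) * \<zeta> p h = (\<zeta> p \<phi> + k p * s p) * Y p h" for h
      unfolding curv[OF Y(1)] s_def gz_def by (simp add: algebra_simps)
    from Y(2)[OF this] show ?thesis by simp
  qed
  \<comment> \<open>The Hessian identity for the pair \<open>X\<close>, \<open>\<zeta>\<close>, in
    which the second derivative collapses because \<open>\<zeta>\<close> reproduces
    \<open>f\<close>.\<close>
  have uX: "(1 - \<phi> p) * X p f = - k p * f p * gz X p" if X: "vector_field A X" for X p
    using hess[OF X Z(1), of p] by (simp add: \<zeta>f Z(2)[OF X] vf_scale_def gz_def algebra_simps)
  have u: "1 - \<phi> p = - k p * s p" for p
  proof -
    have "f p * (1 - \<phi> p) = f p * (- k p * s p)"
      using uX[OF Z(1), of p] by (simp add: \<zeta>f gz_def s_def algebra_simps)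
    then show ?thesis using f(2)[of p] mult_left_cancel[of "f p"] by (metis less_irrefl)
  qed
  \<comment> \<open>Multiplication by \<open>s\<close> trades \<open>- k s\<close> for
    \<open>1 - \<phi>\<close>, which removes \<open>k\<close>, whose regularity is unknown. The
    factor \<open>1 - \<phi>\<close> is kept on both sides so that the identity holds at every point
    and may be differentiated.\<close>
  have F0: "(1 - \<phi> p) * (s p * X p f) = (1 - \<phi> p) * (f p * gz X p)" if "vector_field A X" for X p
  proof -
    have "(1 - \<phi> p) * (s p * X p f) = s p * ((1 - \<phi> p) * X p f)" by (simp add: algebra_simps)
    also have "\<dots> = (- k p * s p) * (f p * gz X p)" unfolding uX[OF that] by (simp add: algebra_simps)
    finally show ?thesis by (simp only: u)
  qed
  have half: "\<phi> p = 1 / 2" if N: "1 - \<phi> p \<noteq> 0" for p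
  proof (rule ccontr)
    assume "\<phi> p \<noteq> 1 / 2"
    have F: "s p * X p f = f p * gz X p" if "vector_field A X" for X
      using F0[OF that, of p] N by simp
    have sp: "s p \<noteq> 0" using u[of p] N by auto
    have rank1: "s p * metric_fun g X Y p = gz X p * gz Y p" if X: "vector_field A X" and Y: "vector_field A Y" for X Y
    proof -
      note Yp = vector_field_tangent[OF Y, of p]
      have sm: "smooth_fun_on A UNIV (\<lambda>q. X q f)" by (rule vector_field_smooth[OF X open_UNIV f(1)])
      have sm1: "smooth_at A p (\<lambda>q. 1 + (-1) * \<phi> q)"
        by (intro smooth_at_UNIV smooth_fun_on_add smooth_fun_on_mult smooth_fun_on_const \<phi>) auto
      have sm2: "smooth_at A p (\<lambda>q. s q * X q f)" "smooth_at A p (\<lambda>q. f q * gz X q)"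
        by (intro smooth_at_UNIV smooth_fun_on_mult sm s_smooth f gz_smooth X open_UNIV)+
      \<comment> \<open>\<open>F\<close> is stated at \<open>p\<close> alone, so \<open>F0\<close>
        is differentiated instead; the terms containing the derivative of \<open>1 - \<phi>\<close>
        agree on both sides by \<open>F\<close>.\<close>
      have "(\<lambda>q. (1 + (-1) * \<phi> q) * (s q * X q f)) = (\<lambda>q. (1 + (-1) * \<phi> q) * (f q * gz X q))"
        using F0[OF X] by auto
      then have "(1 - \<phi> p) * Y p (\<lambda>q. s q * X q f) = (1 - \<phi> p) * Y p (\<lambda>q. f q * gz X q)"
        using tangent_vec_mult[OF Yp sm1 sm2(1)] tangent_vec_mult[OF Yp sm1 sm2(2)] F[OF X] by simp
      then have "Y p (\<lambda>q. s q * X q f) = Y p (\<lambda>q. f q * gz X q)" using N by simp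
      then have 1: "s p * Y p (\<lambda>q. X q f) + Y p s * X p f = f p * Y p (gz X) + Y p f * gz X p"
        using tangent_vec_mult[OF Yp smooth_at_UNIV smooth_at_UNIV, of s "\<lambda>q. X q f"]
          tangent_vec_mult[OF Yp smooth_at_UNIV smooth_at_UNIV, of f "gz X"]
          s_smooth f gz_smooth[OF X] sm by simp
      have 2: "Y p s = 2 * \<phi> p * gz Y p"
        using metric_fun_sym[OF bil Z(1) V[OF Y Z(1)]]
        by (simp add: s_def gz_def levi_civita_compatible[OF D Y Z(1) Z(1)] Z(2)[OF Y] metric_fun_scale[OF bil Y Z(1)])
      have 3: "Y p (gz X) = gz (D Y X) p + \<phi> p * metric_fun g X Y p"
        using metric_fun_sym[OF bil X V[OF Y Z(1)]] metric_fun_sym[OF bil X Y]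
        by (simp add: gz_def levi_civita_compatible[OF D Y X Z(1)] Z(2)[OF Y] metric_fun_scale[OF bil Y X])
      have 4: "Y p (\<lambda>q. X q f) = D Y X p f - k p * f p * metric_fun g X Y p"
        using hess[OF Y X, of p] metric_fun_sym[OF bil X Y] by simp
      \<comment> \<open>\<open>F\<close> for the field \<open>D Y X\<close>, together with
        \<open>- k s = 1 - \<phi>\<close>, removes the second derivative of \<open>f\<close> and
        \<open>k\<close> with it.\<close>
      have "s p * (D Y X p f) = f p * gz (D Y X) p" by (rule F[OF V[OF Y X]])
      then have "s p * Y p (\<lambda>q. X q f) = f p * gz (D Y X) p + (1 - \<phi> p) * f p * metric_fun g X Y p"
        unfolding 4 u[of p] by (simp add: algebra_simps)
      with 1 2 3 have 5: "2 * \<phi> p * gz Y p * X p f - Y p f * gz X p = (2 * \<phi> p - 1) * f p * metric_fun g X Y p"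
        by (simp add: algebra_simps)
      \<comment> \<open>Multiplying by \<open>s\<close> lets \<open>F\<close> replace the two
        remaining derivatives of \<open>f\<close> by values of \<open>gz\<close>.\<close>
      have "(2 * \<phi> p - 1) * f p * (s p * metric_fun g X Y p) =
          s p * (2 * \<phi> p * gz Y p * X p f - Y p f * gz X p)"
        unfolding 5 by (simp add: algebra_simps)
      also have "\<dots> = 2 * \<phi> p * gz Y p * (s p * X p f) - (s p * Y p f) * gz X p"
        by (simp add: algebra_simps)
      also have "\<dots> = (2 * \<phi> p - 1) * f p * (gz X p * gz Y p)"
        unfolding F[OF X] F[OF Y] by (simp add: algebra_simps)
      finally show ?thesis using f(2)[of p] \<open>\<phi> p \<noteq> 1 / 2\<close> by simp
    qed
    \<comment> \<open>By \<open>rank1\<close> and nondegeneracy, \<open>s X\<close> equals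
      \<open>gz X\<close> times \<open>\<zeta>\<close> at \<open>p\<close>, whatever
      \<open>X\<close> is. A direction independent of \<open>\<zeta>\<close> then forces
      \<open>s p = 0\<close>.\<close>
    obtain X where X: "vector_field A X" "\<And>a b. (\<And>h. a * \<zeta> p h = b * X p h) \<Longrightarrow> b = 0"
      using independent_vector_field[OF dim vector_field_tangent[OF Z(1)]] by metis
    note T = vector_field_tangent[OF X(1), of p] vector_field_tangent[OF Z(1), of p]
    have "(\<lambda>h. gz X p * \<zeta> p h) = (\<lambda>h. s p * X p h)"
    proof (rule metric_nondegenerate[OF g, of _ p])
      show "(\<lambda>h. gz X p * \<zeta> p h) \<in> tangent_space A p" "(\<lambda>h. s p * X p h) \<in> tangent_space A p"
        using tangent_space_lincomb[OF T(2,2), of "gz X p" 0] tangent_space_lincomb[OF T(1,1), of "s p" 0]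
        by simp_all
      fix Y assume Y: "vector_field A Y"
      show "g p (\<lambda>h. gz X p * \<zeta> p h) (Y p) = g p (\<lambda>h. s p * X p h) (Y p)"
        using rank1[OF X(1) Y] metric_fun_sym[OF bil Y Z(1)] metric_scale[OF bil T(2) vector_field_tangent[OF Y]]
          metric_scale[OF bil T(1) vector_field_tangent[OF Y]]
        by (simp add: gz_def metric_fun_def fun_eq_iff)
    qed
    then have "s p = 0" by (intro X(2)[of "gz X p"]) (simp add: fun_eq_iff)
    with sp show False ..
  qed
  have "1 - \<phi> p = 0" for p
  proof (rule ccontr)
    assume N: "1 - \<phi> p \<noteq> 0"
    \<comment> \<open>\<open>\<phi>\<close> takes only the values 1 and 1/2, the roots of x^2 -
      (3/2) x + 1/2. Differentiating this identity along \<open>\<zeta>\<close> replaces a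
      continuity argument: at \<open>p\<close>, where \<open>\<phi>\<close> is 1/2, the derivative
      of \<open>\<phi>\<close> must vanish, although it equals \<open>1 - \<phi>\<close>.\<close>
    have sq: "(\<lambda>q. \<phi> q * \<phi> q) = (\<lambda>q. (- 1 / 2) + (3 / 2) * \<phi> q)"
    proof
      fix q
      show "\<phi> q * \<phi> q = (- 1 / 2) + (3 / 2) * \<phi> q"
      proof (cases "1 - \<phi> q = 0")
        case False
        show ?thesis unfolding half[OF False] by simp
      qed simp
    qed
    note T = vector_field_tangent[OF Z(1), of p]
    have c: "smooth_at A p (\<lambda>q. c)" "smooth_at A p \<phi>" "smooth_at A p (\<lambda>q. c * \<phi> q)" for c
      by (intro smooth_at_UNIV smooth_fun_on_mult smooth_fun_on_const \<phi> open_UNIV)+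
    have "2 * \<phi> p * \<zeta> p \<phi> = \<zeta> p (\<lambda>q. \<phi> q * \<phi> q)"
      by (simp add: tangent_vec_mult[OF T c(2,2)])
    also have "\<dots> = (3 / 2) * \<zeta> p \<phi>"
      unfolding sq tangent_vec_add[OF T c(1,3)] tangent_vec_mult[OF T c(1,2)] tangent_vec_const[OF T]
      by simp
    finally have "2 * \<phi> p * \<zeta> p \<phi> = (3 / 2) * \<zeta> p \<phi>" .
    then have "\<zeta> p \<phi> = 0" using half[OF N] by simp
    then show False using \<zeta>\<phi>[of p] u[of p] N by simp
  qed
  \<comment> \<open>With \<open>\<phi> = 1\<close>, \<open>uX\<close> reduces to
    \<open>k f (gz X) = 0\<close>. If \<open>k p\<close> were nonzero, \<open>\<zeta> p\<close>
    would be orthogonal to everything, hence 0, against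
    \<open>\<zeta> p f = f p > 0\<close>.\<close>
  then have kg: "k p = 0 \<or> gz X p = 0" if "vector_field A X" for X
    using uX[OF that, of p] f(2)[of p] by simp
  show ?thesis
  proof (rule ccontr)
    assume "k p \<noteq> 0"
    then have "\<zeta> p = vf_zero p"
      using kg metric_fun_zero(1)[OF bil] metric_fun_sym[OF bil Z(1)]
      by (intro metric_nondegenerate[OF g vector_field_tangent[OF Z(1)] vector_field_tangent[OF vector_field_zero]])
        (auto simp: metric_fun_def gz_def fun_eq_iff)
    then show False using \<zeta>f[of p] f(2)[of p] by (simp add: vf_zero_def)
  qed
qed

end

section \<open>Warped products\<close>

locale warped_product = product_manifold A1 A2
  for A1 :: "('a::{t2_space,second_countable_topology}, 'e1::euclidean_space) atlas"
    and A2 :: "('b::{t2_space,second_countable_topology}, 'e2::euclidean_space) atlas" +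
  fixes g1 :: "'a metric" and g2 :: "'b metric" and f :: "'a \<Rightarrow> real"
    and D1 :: "'a connection" and D2 :: "'b connection" and D :: "('a \<times> 'b) connection"
  assumes g1: "pseudo_riemannian_metric A1 g1" and g2: "pseudo_riemannian_metric A2 g2"
    and f: "smooth_fun_on A1 UNIV f" and f_pos: "0 < f p"
    and D1: "levi_civita A1 g1 D1" and D2: "levi_civita A2 g2 D2"
    and D: "levi_civita (product_atlas A1 A2) (warped_metric A1 A2 f g1 g2) D"
begin

abbreviation "G \<equiv> warped_metric A1 A2 f g1 g2"
abbreviation "lift1 X \<equiv> lift A1 A2 X vf_zero"
abbreviation "lift2 \<equiv> lift A1 A2 vf_zero"

lemmas bilinear1 = pseudo_riemannian_metric_bilinear[OF g1]
lemmas bilinear2 = pseudo_riemannian_metric_bilinear[OF g2]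
lemmas affine = levi_civita_affine[OF D]

lemma warped_bilinear: "symmetric_bilinear P G"
proof -
  have pl: "pushforward B F p (\<lambda>h. a * u h + b * v h) =
      (\<lambda>h. a * pushforward B F p u h + b * pushforward B F p v h)"
    for B :: "('c::topological_space, 'e::euclidean_space) atlas" and F :: "'d \<Rightarrow> 'c" and p a u b v
    by (auto simp: pushforward_def)
  show ?thesis
    using bilinear1 bilinear2 unfolding symmetric_bilinear_def warped_metric_def pullback_metric_def
    by (auto simp: pl pushforward_in_tangent_space algebra_simps)
qed

lemma metric_lift:
  assumes "vector_field A1 X" "vector_field A2 Y" "vector_field A1 X'" "vector_field A2 Y'"
  shows "metric_fun G (lift A1 A2 X Y) (lift A1 A2 X' Y') =
    (\<lambda>z. metric_fun g1 X X' (fst z) + (f (fst z))\<^sup>2 * metric_fun g2 Y Y' (snd z))"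
  using assms by (simp add: metric_fun_def warped_metric_def pullback_metric_def pushforward_lift)

lemma lift_apply_metric:
  assumes "vector_field A1 X" "vector_field A2 Y" "vector_field A1 X'" "vector_field A2 Y'"
    "vector_field A1 X''" "vector_field A2 Y''"
  shows "lift A1 A2 X Y z (metric_fun G (lift A1 A2 X' Y') (lift A1 A2 X'' Y'')) =
    X (fst z) (metric_fun g1 X' X'') + X (fst z) (\<lambda>p. (f p)\<^sup>2) * metric_fun g2 Y' Y'' (snd z)
    + (f (fst z))\<^sup>2 * Y (snd z) (metric_fun g2 Y' Y'')"
  unfolding metric_lift[OF assms(3-6)]
proof (rule lift_apply_warped[OF assms(1,2)])
  show "smooth_fun_on A1 UNIV (metric_fun g1 X' X'')" "smooth_fun_on A2 UNIV (metric_fun g2 Y' Y'')"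
    using g1 g2 assms by (simp_all add: pseudo_riemannian_metric_def)
  show "smooth_fun_on A1 UNIV (\<lambda>p. (f p)\<^sup>2)"
    unfolding power2_eq_square by (intro M1.smooth_fun_on_mult f open_UNIV)
qed

text \<open>Lifts with one zero component test the two pushforwards separately; in the vertical test
  \<open>f\<^sup>2\<close> is divided out. Koszul values on lifts therefore determine a covariant
  derivative.\<close>

lemma warped_nondegenerate:
  assumes S: "vector_field P S" and T: "vector_field P T"
    and eq: "\<And>X Y z. vector_field A1 X \<Longrightarrow> vector_field A2 Y \<Longrightarrow>
      metric_fun G S (lift A1 A2 X Y) z = metric_fun G T (lift A1 A2 X Y) z"
  shows "S = T"
proof -
  note ST = M.vector_field_tangent[OF S] M.vector_field_tangent[OF T]
  have 1: "pushforward A1 fst z (S z) = pushforward A1 fst z (T z)" for z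
  proof (rule M1.metric_nondegenerate[OF g1 pushforward_in_tangent_space(1)[OF ST(1)]
        pushforward_in_tangent_space(1)[OF ST(2)]])
    fix X assume X: "vector_field A1 X"
    have "g2 q u (vf_zero q) = 0" if "u \<in> tangent_space A2 q" for u q
      using M2.metric_fun_zero(2)[OF bilinear2] M2.tangent_vec_extend[OF that]
      by (metis metric_fun_def)
    then show "g1 (fst z) (pushforward A1 fst z (S z)) (X (fst z)) =
        g1 (fst z) (pushforward A1 fst z (T z)) (X (fst z))"
      using eq[OF X M2.vector_field_zero, of z] X ST
      by (simp add: metric_fun_def warped_metric_def pullback_metric_def pushforward_lift
          M2.vector_field_zero pushforward_in_tangent_space)
  qed
  have 2: "pushforward A2 snd z (S z) = pushforward A2 snd z (T z)" for z
  proof (rule M2.metric_nondegenerate[OF g2 pushforward_in_tangent_space(2)[OF ST(1)]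
        pushforward_in_tangent_space(2)[OF ST(2)]])
    fix Y assume Y: "vector_field A2 Y"
    show "g2 (snd z) (pushforward A2 snd z (S z)) (Y (snd z)) =
        g2 (snd z) (pushforward A2 snd z (T z)) (Y (snd z))"
      using eq[OF M1.vector_field_zero Y, of z] Y f_pos[of "fst z"] 1[of z]
      by (simp add: metric_fun_def warped_metric_def pullback_metric_def pushforward_lift
          M1.vector_field_zero)
  qed
  show ?thesis
  proof (rule vector_field_eqI[OF S T])
    show "S z (\<lambda>z. a (fst z)) = T z (\<lambda>z. a (fst z))" for z a
      using 1[of z] by (simp add: pushforward_apply(1)[OF ST(1), symmetric] pushforward_apply(1)[OF ST(2), symmetric])
    show "S z (\<lambda>z. b (snd z)) = T z (\<lambda>z. b (snd z))" for z b
      using 2[of z] by (simp add: pushforward_apply(2)[OF ST(1), symmetric] pushforward_apply(2)[OF ST(2), symmetric])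
  qed
qed

lemma bracket_lift:
  assumes "vector_field A1 X" "vector_field A2 Y" "vector_field A1 X'" "vector_field A2 Y'"
  shows "lie_bracket P (lift A1 A2 X Y) (lift A1 A2 X' Y') =
    lift A1 A2 (lie_bracket A1 X X') (lie_bracket A2 Y Y')"
  using assms
  by (intro lie_bracket_lift M1.vector_field_lie_bracket[OF D1] M2.vector_field_lie_bracket[OF D2]
      M.vector_field_lie_bracket[OF D] vector_field_lift)

lemmas vector_fields = M1.vector_field_zero M2.vector_field_zero vector_field_lift
  M1.vector_field_lie_bracket[OF D1] M2.vector_field_lie_bracket[OF D2]
  connection_vector_field[OF levi_civita_affine[OF D1]] connection_vector_field[OF affine]

lemmas zero_simps = M1.metric_fun_zero[OF bilinear1] M2.metric_fun_zero[OF bilinear2]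
  M1.lie_bracket_zero M2.lie_bracket_zero

lemma vf_zero_apply [simp]: "vf_zero p h = 0"
  by (simp add: vf_zero_def)

section \<open>Connection and curvature on lifted fields\<close>

lemma connection_lift1_lift1:
  assumes X: "vector_field A1 X" and Z: "vector_field A1 Z"
  shows "D (lift1 X) (lift1 Z) = lift1 (D1 X Z)"
proof (rule warped_nondegenerate)
  fix W V z assume W: "vector_field A1 W" and V: "vector_field A2 V"
  have "2 * metric_fun G (D (lift1 X) (lift1 Z)) (lift A1 A2 W V) z = 2 * metric_fun g1 (D1 X Z) W (fst z)"
    unfolding M.koszul[OF warped_bilinear D vector_field_lift[OF X M2.vector_field_zero]
        vector_field_lift[OF Z M2.vector_field_zero] vector_field_lift[OF W V]]
      M1.koszul[OF bilinear1 D1 X Z W]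
    \<comment> \<open>The order matters: \<open>metric_lift\<close> would rewrite the inner metric
      functions before \<open>lift_apply_metric\<close> could match them.\<close>
    by (simp only: lift_apply_metric bracket_lift vector_fields X Z W V)
      (simp add: metric_lift vector_fields zero_simps
        M1.vector_field_apply_const M2.vector_field_apply_const X Z W V)
  then show "metric_fun G (D (lift1 X) (lift1 Z)) (lift A1 A2 W V) z =
      metric_fun G (lift1 (D1 X Z)) (lift A1 A2 W V) z"
    by (simp add: metric_lift vector_fields zero_simps X Z W V)
qed (use X Z vector_fields in auto)

lemma smooth_log_derivative:
  assumes X: "vector_field A1 X"
  shows "smooth_fun_on A1 UNIV (\<lambda>p. X p f / f p)"
  using f_pos by (intro M1.smooth_fun_on_divide M1.vector_field_smooth[OF X] f open_UNIV)
    (simp add: less_imp_neq[THEN not_sym])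

lemma smooth_fst: "smooth_fun_on A1 UNIV a \<Longrightarrow> smooth_fun_on P UNIV (\<lambda>z. a (fst z))"
  using smooth_fun_on_fst[of UNIV a] by simp

text \<open>The only surviving Koszul term is the derivative of \<open>f\<^sup>2\<close> along
  \<open>X\<close> times the metric of the second factor. As it is \<open>2 f (X f)\<close>,
  dividing by \<open>2 f\<^sup>2\<close> gives the logarithmic derivative of
  \<open>f\<close>.\<close>

lemma connection_lift1_lift2:
  assumes X: "vector_field A1 X" and V: "vector_field A2 V"
  shows "D (lift1 X) (lift2 V) = vf_scale (\<lambda>z. X (fst z) f / f (fst z)) (lift2 V)"
proof (rule warped_nondegenerate)
  show "vector_field P (vf_scale (\<lambda>z. X (fst z) f / f (fst z)) (lift2 V))"
    by (intro M.vector_field_scale vector_fields V smooth_fst smooth_log_derivative X)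
  fix W V' and z :: "'a \<times> 'b" assume W: "vector_field A1 W" and V': "vector_field A2 V'"
  have "X (fst z) (\<lambda>p. (f p)\<^sup>2) = 2 * f (fst z) * X (fst z) f"
    unfolding power2_eq_square
    by (simp add: M1.tangent_vec_mult[OF M1.vector_field_tangent[OF X] M1.smooth_at_UNIV[OF f] M1.smooth_at_UNIV[OF f]])
  then have "2 * metric_fun G (D (lift1 X) (lift2 V)) (lift A1 A2 W V') z =
      2 * (X (fst z) f / f (fst z) * ((f (fst z))\<^sup>2 * metric_fun g2 V V' (snd z)))"
    unfolding M.koszul[OF warped_bilinear D vector_field_lift[OF X M2.vector_field_zero]
        vector_field_lift[OF M1.vector_field_zero V] vector_field_lift[OF W V']]
    using f_pos[of "fst z"]
    by (simp only: lift_apply_metric bracket_lift vector_fields X V W V')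
      (simp add: metric_lift vector_fields zero_simps
        M1.vector_field_apply_const M2.vector_field_apply_const X V W V' power2_eq_square)
  then show "metric_fun G (D (lift1 X) (lift2 V)) (lift A1 A2 W V') z =
      metric_fun G (vf_scale (\<lambda>z. X (fst z) f / f (fst z)) (lift2 V)) (lift A1 A2 W V') z"
    by (simp add: M.metric_fun_scale[OF warped_bilinear] metric_lift vector_fields zero_simps X V W V')
qed (use X V vector_fields in auto)

lemma bracket_lift1_lift2:
  assumes X: "vector_field A1 X" and V: "vector_field A2 V"
  shows "lie_bracket P (lift1 X) (lift2 V) = vf_zero"
  by (simp add: bracket_lift vector_fields zero_simps X V lift_zero)

lemma connection_lift2_lift1:
  assumes X: "vector_field A1 X" and V: "vector_field A2 V"
  shows "D (lift2 V) (lift1 X) = vf_scale (\<lambda>z. X (fst z) f / f (fst z)) (lift2 V)"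
  using levi_civita_torsion[OF D vector_field_lift[OF X M2.vector_field_zero]
      vector_field_lift[OF M1.vector_field_zero V]]
  by (simp add: bracket_lift1_lift2 X V connection_lift1_lift2 vf_diff_def fun_eq_iff)

text \<open>The bracket vanishes and both iterated derivatives are multiples of \<open>V\<close>:
  one has coefficient \<open>(D1 X Z f) / f\<close>, the other
  \<open>X (Z f / f) + (Z f / f) (X f / f)\<close>. Functions of the second factor read off the
  coefficient of \<open>V\<close>.\<close>

lemma riemann_mixed:
  assumes X: "vector_field A1 X" and Z: "vector_field A1 Z" and V: "vector_field A2 V"
  shows "riemann P D (lift1 X) (lift2 V) (lift1 Z) z (\<lambda>z. b (snd z)) =
    (D1 X Z (fst z) f - X (fst z) (\<lambda>p. Z p f)) / f (fst z) * V (snd z) b"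
proof -
  let ?a = "\<lambda>p. Z p f / f p"
  have XZ: "vector_field A1 (D1 X Z)" by (intro vector_fields X Z)
  have l: "vector_field P (lift1 X)" "vector_field P (lift2 V)" "vector_field P (lift1 Z)"
    by (intro vector_fields X V Z)+
  \<comment> \<open>The product rule for \<open>f\<close> times \<open>?a\<close> does the work of a
    quotient rule.\<close>
  have "(\<lambda>p. f p * ?a p) = (\<lambda>p. Z p f)" using f_pos by (auto simp: less_imp_neq[THEN not_sym])
  then have "X (fst z) (\<lambda>p. Z p f) = f (fst z) * X (fst z) ?a + X (fst z) f * ?a (fst z)"
    using M1.tangent_vec_mult[OF M1.vector_field_tangent[OF X] M1.smooth_at_UNIV[OF f]
        M1.smooth_at_UNIV[OF smooth_log_derivative[OF Z]], of "fst z"] by simp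
  then have coeff: "(D1 X Z (fst z) f - X (fst z) (\<lambda>p. Z p f)) / f (fst z) =
      D1 X Z (fst z) f / f (fst z) - X (fst z) ?a - ?a (fst z) * (X (fst z) f / f (fst z))"
    using f_pos[of "fst z"] by (simp add: field_simps)
  have "lift1 X z (\<lambda>z. ?a (fst z)) = X (fst z) ?a"
    by (rule lift_apply(1)[OF X M2.vector_field_zero])
  then show ?thesis
    unfolding coeff riemann_def bracket_lift1_lift2[OF X V] M.connection_zero_left[OF affine l(3)]
      connection_lift1_lift1[OF X Z] connection_lift2_lift1[OF XZ V] connection_lift2_lift1[OF Z V]
      connection_scale_right[OF affine smooth_fst[OF smooth_log_derivative[OF Z]] l(1,2)]
      connection_lift1_lift2[OF X V]
    by (simp add: vf_add_def vf_diff_def vf_scale_def lift_apply V M1.vector_field_zero algebra_simps)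
qed

text \<open>The slices over a point of the second factor are totally geodesic: by
  \<open>connection_lift1_lift1\<close>, covariant derivatives of horizontal lifts along each other
  remain lifts, as do their brackets.\<close>

lemma riemann_horizontal:
  assumes X: "vector_field A1 X" and Y: "vector_field A1 Y" and Z: "vector_field A1 Z"
  shows "riemann P D (lift1 X) (lift1 Y) (lift1 Z) z (\<lambda>z. a (fst z)) = riemann A1 D1 X Y Z (fst z) a"
  unfolding riemann_def
  by (simp add: bracket_lift zero_simps connection_lift1_lift1 vector_fields X Y Z)
    (simp add: vf_add_def vf_diff_def lift_apply vector_fields X Y Z)

end

theorem theorem4:
  fixes A1 :: "('a::{t2_space,second_countable_topology}, 'e1::euclidean_space) atlas"
    and A2 :: "('b::{t2_space,second_countable_topology}, 'e2::euclidean_space) atlas"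
    and g1 :: "'a metric" and g2 :: "'b metric" and f :: "'a \<Rightarrow> real"
    and D1 :: "'a connection" and D2 :: "'b connection" and D :: "('a \<times> 'b) connection"
  assumes "pseudo_riemannian_manifold A1 g1" and "DIM('e1) \<noteq> 1"
    and "pseudo_riemannian_manifold A2 g2" and "DIM('e2) \<noteq> 1"
    and "smooth_fun_on A1 UNIV f" and "\<forall>p. 0 < f p"
    and "levi_civita A1 g1 D1"
    and "levi_civita A2 g2 D2"
    and "levi_civita (product_atlas A1 A2) (warped_metric A1 A2 f g1 g2) D"
    and "concircularly_flat (product_atlas A1 A2) (warped_metric A1 A2 f g1 g2) D"
    and "\<exists>\<zeta>1. concircular_vector_field A1 D1 \<zeta>1 \<and>
           (((\<exists>\<zeta>2. concircular_vector_field A2 D2 \<zeta>2) \<and> (\<exists>c. \<forall>p. f p = c)) \<or>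
            (\<forall>p. \<zeta>1 p f = f p))"
  shows "flat (product_atlas A1 A2) D"
proof -
  interpret warped_product A1 A2 g1 g2 f D1 D2 D
    using assms by unfold_locales (auto simp: pseudo_riemannian_manifold_def)
  define K where "K z = scalar_curvature P G D z / (real DIM('e1 \<times> 'e2) * (real DIM('e1 \<times> 'e2) - 1))" for z
  have R: "riemann P D X Y Z z h = K z * (metric_fun G X Z z * Y z h - metric_fun G Y Z z * X z h)"
    if "vector_field P X" "vector_field P Y" "vector_field P Z" for X Y Z z h
  proof -
    have "concircular_curvature P G D X Y Z z h = vf_zero z h"
      using assms(10) that unfolding concircularly_flat_def by simp
    then show ?thesis
      by (simp add: concircular_curvature_def K_def vf_diff_def vf_scale_def)
  qed
  have hess: "X p (\<lambda>q. Z q f) = D1 X Z p f - K (p, q) * f p * metric_fun g1 X Z p"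
    if X: "vector_field A1 X" and Z: "vector_field A1 Z" for X Z p q
  proof -
    \<comment> \<open>Vertical and horizontal lifts are orthogonal, so one term of the curvature
      identity drops out; \<open>b\<close> then extracts the coefficient of \<open>V\<close>,
      normalized by \<open>V q b = 1\<close>.\<close>
    obtain V b where V: "vector_field A2 V" "V q b = 1" by (rule M2.vector_field_nonzero)
    have "riemann P D (lift1 X) (lift2 V) (lift1 Z) (p, q) (\<lambda>z. b (snd z)) =
        K (p, q) * metric_fun g1 X Z p"
      by (simp add: R[OF vector_field_lift[OF X M2.vector_field_zero]
            vector_field_lift[OF M1.vector_field_zero V(1)] vector_field_lift[OF Z M2.vector_field_zero]]
          V vector_fields X Z metric_lift lift_apply zero_simps)
    then have "(D1 X Z p f - X p (\<lambda>p. Z p f)) / f p = K (p, q) * metric_fun g1 X Z p"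
      using riemann_mixed[OF X Z V(1), of "(p, q)" b] V(2) by simp
    then show ?thesis using f_pos[of p] by (simp add: field_simps)
  qed
  from assms(11) obtain \<zeta> \<phi> where Z: "vector_field A1 \<zeta>" "smooth_fun_on A1 UNIV \<phi>"
      "\<And>X. vector_field A1 X \<Longrightarrow> D1 X \<zeta> = vf_scale \<phi> X"
    and alt: "(\<exists>c. \<forall>p. f p = c) \<or> (\<forall>p. \<zeta> p f = f p)"
    unfolding concircular_vector_field_def by blast
  have "K (p, q) = 0" for p q
    using alt
  proof
    assume "\<exists>c. \<forall>p. f p = c"
    then obtain c where c: "f = (\<lambda>p. c)" by auto
    \<comment> \<open>For constant \<open>f\<close> both derivatives in \<open>hess\<close> are 0; a
      pair with nonzero product at \<open>p\<close> then isolates \<open>K\<close>.\<close>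
    obtain X Y where X: "vector_field A1 X" "vector_field A1 Y" "metric_fun g1 X Y p \<noteq> 0"
      by (rule M1.metric_nonzero[OF g1])
    have f0: "X' p f = 0" if "vector_field A1 X'" for X' p
      unfolding c using that by (rule M1.vector_field_apply_const)
    have "(\<lambda>q. Y q f) = (\<lambda>q. 0)" "D1 X Y p f = 0"
      using f0[OF X(2)] f0[of "D1 X Y"] X by (simp_all add: vector_fields)
    then have "X p (\<lambda>q. Y q f) = 0" "D1 X Y p f = 0"
      using M1.vector_field_apply_const[OF X(1)] by simp_all
    then show ?thesis using hess[OF X(1,2), of p q] f_pos[of p] X(3) by simp
  next
    assume \<zeta>f: "\<forall>p. \<zeta> p f = f p"
    have dim: "2 \<le> DIM('e1)" using assms(2) DIM_positive[where 'a = 'e1] by linarith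
    \<comment> \<open>The curvature identity on horizontal lifts, read on the slice through
      \<open>q\<close>.\<close>
    have curv: "riemann A1 D1 \<zeta> Y \<zeta> p h =
        K (p, q) * (metric_fun g1 \<zeta> \<zeta> p * Y p h - metric_fun g1 Y \<zeta> p * \<zeta> p h)"
      if Y: "vector_field A1 Y" for Y p h
      using riemann_horizontal[OF Z(1) Y Z(1), of "(p, q)" h, symmetric] Z(1) Y
      by (simp add: R vector_fields metric_lift lift_apply zero_simps)
    show ?thesis
      \<comment> \<open>With \<open>q\<close> fixed, \<open>K\<close> becomes a function on the base
        alone.\<close>
      by (rule M1.concircular_gradient_imp_flat[where g = g1 and D = D1 and f = f and \<zeta> = \<zeta>
            and \<phi> = \<phi> and k = "\<lambda>p. K (p, q)"])
        (use g1 D1 dim f f_pos Z \<zeta>f hess curv in auto)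
  qed
  then have "K z = 0" for z by (cases z) auto
  then show ?thesis
    unfolding flat_def by (simp add: R fun_eq_iff)
qed

end
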